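(* Let $n\geq 5$. If an element of $Br(S^2,n)$ is reducible, then it is trivial.
   Context: Fix distinct points $y_1,\dots,y_n\in S^2$. $M(S^2,n)$ is the group of isotopy classes of orientation-preserving homeomorphisms of $S^2$ preserving $\{y_1,\dots,y_n\}$; $M_p(S^2,n)$ the subgroup of classes fixing each $y_i$; $L_i\colon M_p(S^2,n)\to M_p(S^2,n-1)$ the map forgetting $y_i$; $Br(S^2,n)=\bigcap_{i=1}^n\ker(L_i)$. A mapping class is reducible if it has a representative leaving invariant a nonempty collection of disjoint essential simple closed curves in $S^2\setminus\{y_1,\dots,y_n\}$, none of which is isotopic to a simple loop around a single point $y_i$ (so each such curve separates the points into two sets of size at least $2$). *)

theory Defs
  imports "HOL-Analysis.Analysis" "HOL-Homology.Homology"
begin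

text \<open>The 2-sphere S^2, realised as the standard unit sphere in the first three
coordinates of nat \<Rightarrow> real (the carrier of nsphere 2 from HOL-Homology).\<close>
definition S2 :: "(nat \<Rightarrow> real) set" where
  "S2 = topspace (nsphere 2)"

definition orient_pres_homeo :: "((nat \<Rightarrow> real) \<Rightarrow> (nat \<Rightarrow> real)) \<Rightarrow> bool" where
  "orient_pres_homeo f \<longleftrightarrow> (\<exists>g. homeomorphism S2 S2 f g) \<and> Brouwer_degree2 2 f = 1"

definition isotopic_rel :: "(nat \<Rightarrow> real) set \<Rightarrow> ((nat \<Rightarrow> real) \<Rightarrow> (nat \<Rightarrow> real))
     \<Rightarrow> ((nat \<Rightarrow> real) \<Rightarrow> (nat \<Rightarrow> real)) \<Rightarrow> bool" where
  "isotopic_rel Y f g \<longleftrightarrow>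
     (\<exists>H :: real \<times> (nat \<Rightarrow> real) \<Rightarrow> (nat \<Rightarrow> real).
        continuous_on ({0..1} \<times> S2) H \<and> H ` ({0..1} \<times> S2) \<subseteq> S2 \<and>
        (\<forall>x\<in>S2. H (0, x) = f x) \<and> (\<forall>x\<in>S2. H (1, x) = g x) \<and>
        (\<forall>t\<in>{0..1}. (\<exists>k. homeomorphism S2 S2 (\<lambda>x. H (t, x)) k) \<and> (\<lambda>x. H (t, x)) ` Y = Y))"

definition pure_mc :: "nat \<Rightarrow> (nat \<Rightarrow> nat \<Rightarrow> real) \<Rightarrow> ((nat \<Rightarrow> real) \<Rightarrow> (nat \<Rightarrow> real)) \<Rightarrow> bool" where
  "pure_mc n y f \<longleftrightarrow> orient_pres_homeo f \<and> (\<forall>i<n. f (y i) = y i)"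

text \<open>f represents an element of Br(S^2,n) = intersection of the kernels of the
forgetful maps L_i: after forgetting y_i, f is isotopic to the identity.\<close>
definition in_Br :: "nat \<Rightarrow> (nat \<Rightarrow> nat \<Rightarrow> real) \<Rightarrow> ((nat \<Rightarrow> real) \<Rightarrow> (nat \<Rightarrow> real)) \<Rightarrow> bool" where
  "in_Br n y f \<longleftrightarrow> pure_mc n y f \<and>
     (\<forall>i<n. isotopic_rel (y ` ({..<n} - {i})) f id)"

definition simple_closed_curve :: "(nat \<Rightarrow> real) set \<Rightarrow> bool" where
  "simple_closed_curve C \<longleftrightarrow>
     (\<exists>c. simple_path c \<and> pathfinish c = pathstart c \<and> path_image c = C)"

text \<open>Essential curve in S^2 minus Y, not bounding a once-punctured disc: a simple closed
curve in S^2 - Y such that each complementary region contains at least 2 marked points.\<close>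
definition essential_curve :: "(nat \<Rightarrow> real) set \<Rightarrow> (nat \<Rightarrow> real) set \<Rightarrow> bool" where
  "essential_curve Y C \<longleftrightarrow> simple_closed_curve C \<and> C \<subseteq> S2 - Y \<and>
     (\<forall>K \<in> components (S2 - C). 2 \<le> card (K \<inter> Y))"

definition reducible :: "(nat \<Rightarrow> real) set \<Rightarrow> ((nat \<Rightarrow> real) \<Rightarrow> (nat \<Rightarrow> real)) \<Rightarrow> bool" where
  "reducible Y f \<longleftrightarrow>
     (\<exists>g \<CC>. orient_pres_homeo g \<and> g ` Y = Y \<and> isotopic_rel Y f g \<and>
        \<CC> \<noteq> {} \<and> pairwise disjnt \<CC> \<and> (\<forall>C\<in>\<CC>. essential_curve Y C) \<and>
        (\<lambda>C. g ` C) ` \<CC> = \<CC>)"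

end

theory Submission
  imports Defs
begin

text \<open>
  Replace \<open>f\<close> by the isotopic homeomorphism \<open>g\<close> with \<open>g(C) = C\<close> or \<open>g(C)\<close> disjoint from \<open>C\<close>, and put a
  marked point at infinity, so that \<open>C\<close> becomes a Jordan curve in the plane with at least two
  marked points inside and at least one more outside. Let \<open>p, b\<close> be marked points inside and \<open>a\<close> one outside.
  The isotopy \<open>F\<close> from \<open>g\<close> to the identity relative to all marked points but \<open>p\<close> moves \<open>p\<close> along a loop
  \<open>\<gamma>\<close>. If \<open>\<gamma>\<close> is null-homotopic in the complement of the other marked points, then \<open>F\<close> can be
  corrected by point pushes to fix \<open>p\<close> as well.

  Moving the traced point from \<open>p\<close> towards \<open>b\<close> inside \<open>C\<close> deforms \<open>\<gamma>\<close> into a loop that does not meet the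
  outside of the larger one of the nested curves \<open>C\<close> and \<open>g(C)\<close>. The isotopy \<open>G\<close> from \<open>g\<close> to the
  identity that is free at \<open>a\<close> fixes \<open>p\<close>; comparing its traces with those of \<open>F\<close> shows that \<open>\<gamma>\<close> is
  null-homotopic once the outer marked points are filled in. Near \<open>b\<close> the two traces could differ by a power of
  a small circle around \<open>b\<close>; a fifth marked point \<open>d\<close>, fixed by both isotopies, rules this out. As the outside
  is connected and contains infinity, the filled-in points can be removed again without affecting
  null-homotopy of the loop.
\<close>

section \<open>Homotopies of paths in the punctured plane\<close>

lemma homotopic_paths_square:
  fixes Q :: "real \<times> real \<Rightarrow> 'a::topological_space"
  assumes contQ: "continuous_on ({0..1} \<times> {0..1}) Q" and QS: "Q ` ({0..1} \<times> {0..1}) \<subseteq> S"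
  shows "homotopic_paths S (\<lambda>t. Q (t, 0))
           ((\<lambda>s. Q (0, s)) +++ (\<lambda>t. Q (t, 1)) +++ reversepath (\<lambda>s. Q (1, s)))"
proof -
  let ?I = "{0..1::real} \<times> {0..1::real}"
  have I: "convex ?I"
    by (simp add: convex_Times)
  define l1 l2 l3 l4 where "l1 = linepath (0::real,0::real) (1,0)" and "l2 = linepath (0::real,0::real) (0,1)"
    and "l3 = linepath (0::real,1::real) (1,1)" and "l4 = linepath (1::real,0::real) (1,1)"
  have sub: "path_image l1 \<subseteq> ?I" "path_image l2 \<subseteq> ?I" "path_image l3 \<subseteq> ?I" "path_image l4 \<subseteq> ?I"
    unfolding l1_def l2_def l3_def l4_def path_image_linepath
    by (intro closed_segment_subset I; simp)+
  have "homotopic_paths ?I l1 (l2 +++ l3 +++ reversepath l4)"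
  proof -
    have "simply_connected ?I"
      using I convex_imp_simply_connected by blast
    moreover have "path (l2 +++ l3 +++ reversepath l4)"
      by (auto simp: l2_def l3_def l4_def)
    moreover have "path_image (l2 +++ l3 +++ reversepath l4) \<subseteq> ?I"
      using sub by (simp add: subset_path_image_join)
    moreover have "path l1" by (simp add: l1_def)
    ultimately show ?thesis
      using sub unfolding simply_connected_eq_homotopic_paths
      by (auto simp: l1_def l2_def l4_def)
  qed
  then have "homotopic_paths S (Q \<circ> l1) (Q \<circ> (l2 +++ l3 +++ reversepath l4))"
    using contQ QS by (intro homotopic_paths_continuous_image) auto
  moreover have "Q \<circ> l1 = (\<lambda>t. Q (t, 0))" "Q \<circ> l2 = (\<lambda>t. Q (0, t))" "Q \<circ> l3 = (\<lambda>t. Q (t, 1))"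
      "Q \<circ> reversepath l4 = reversepath (\<lambda>t. Q (1, t))"
    by (auto simp: l1_def l2_def l3_def l4_def linepath_def reversepath_def fun_eq_iff)
  ultimately show ?thesis
    by (simp add: path_compose_join)
qed

text \<open>Scaling the factor to \<open>exp (u * L t)\<close> gives the homotopy. Its distance from
  \<open>b\<close> is monotone in \<open>u\<close>, so it stays below \<open>r\<close> because it
  does at \<open>u = 0\<close> and \<open>u = 1\<close>, and it never reaches 0. The zeros of
  \<open>L\<close> at both ends, which say that the relative winding number about \<open>b\<close>
  is 0, keep the endpoints fixed.\<close>

lemma homotopic_paths_punctured_ball:
  fixes m m' L :: "real \<Rightarrow> complex"
  assumes m': "path m'" "path_image m' \<subseteq> ball b r - {b}"
    and m: "path_image m \<subseteq> ball b r - {b}"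
    and L: "continuous_on {0..1} L" "L 0 = 0" "L 1 = 0"
    and eq: "\<And>t. t \<in> {0..1} \<Longrightarrow> m t - b = (m' t - b) * exp (L t)"
  shows "homotopic_paths (ball b r - {b}) m' m"
proof -
  define h where "h = (\<lambda>(u::real, t). b + (m' t - b) * exp (of_real u * L t))"
  have cm': "continuous_on {0..1} m'"
    using m' by (simp add: path_def)
  have "continuous_on ({0..1} \<times> {0..1}) h"
    unfolding h_def case_prod_unfold
    by (intro continuous_intros continuous_on_compose2 [OF cm'] continuous_on_compose2 [OF L(1)]) auto
  moreover have "h (u, t) \<in> ball b r - {b}" if u: "u \<in> {0..1}" and t: "t \<in> {0..1}" for u t
  proof -
    have n': "norm (m' t - b) < r" "m' t \<noteq> b" and n: "norm (m t - b) < r"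
      using m m' t by (force simp: path_image_def dist_norm norm_minus_commute)+
    have "norm (m' t - b) * exp (u * Re (L t)) < r"
    proof (cases "Re (L t) \<le> 0")
      case True
      then have "exp (u * Re (L t)) \<le> 1"
        using u by (simp add: mult_nonneg_nonpos)
      then show ?thesis
        using n' mult_left_le norm_ge_zero by (metis order_le_less_trans)
    next
      case False
      then have "u * Re (L t) \<le> Re (L t)"
        using u by (simp add: mult_left_le_one_le)
      then have "norm (m' t - b) * exp (u * Re (L t)) \<le> norm (m' t - b) * exp (Re (L t))"
        by (simp add: mult_left_mono)
      also have "\<dots> = norm (m t - b)"
        by (simp add: eq [OF t] norm_mult)
      finally show ?thesis using n by simp
    qed
    then show ?thesis
      using n' by (simp add: h_def dist_norm norm_minus_commute norm_mult)
  qed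
  moreover have "h (1, t) = m t" if "t \<in> {0..1}" for t
    using eq [OF that] by (simp add: h_def) (metis add.commute diff_add_cancel)
  moreover have "m' 1 = m 1" "m' 0 = m 0"
    using eq [of 1] eq [of 0] L by auto
  ultimately show ?thesis
    unfolding homotopic_paths using L
    by (intro exI [of _ h]) (auto simp: pathstart_def pathfinish_def h_def)
qed

text \<open>The values lie in the discrete set of integer multiples of
  \<open>2 * pi * \<i>\<close>.\<close>

lemma exp_eq_1_imp_constant_on:
  fixes h :: "'a::topological_space \<Rightarrow> complex"
  assumes S: "connected S" "continuous_on S h" and e: "\<And>x. x \<in> S \<Longrightarrow> exp (h x) = 1"
    and xy: "x \<in> S" "y \<in> S"
  shows "h x = h y"
proof -
  have "h constant_on S"
  proof (rule continuous_discrete_range_constant [OF S])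
    fix x assume x: "x \<in> S"
    have "2 * pi \<le> norm (h y - h x)" if "y \<in> S" "h y \<noteq> h x" for y
    proof -
      have "exp (h y) = exp (h x)"
        using e x that by simp
      then obtain n :: int where n: "h y = h x + of_int (2 * n) * pi * \<i>"
        unfolding exp_eq by (metis of_real_of_int_eq of_real_mult)
      with that have "n \<noteq> 0" by auto
      then have "1 \<le> \<bar>real_of_int n\<bar>" by linarith
      then show ?thesis
        by (simp add: n norm_mult abs_mult)
    qed
    then show "\<exists>e>0. \<forall>y. y \<in> S \<and> h y \<noteq> h x \<longrightarrow> e \<le> cmod (h y - h x)"
      by (intro exI [of _ "2 * pi"]) auto
  qed
  then show ?thesis
    using xy by (auto simp: constant_on_def)
qed

text \<open>As both isotopies fix \<open>d\<close>, their traces at \<open>d\<close> do not wind around \<open>b\<close> relative to each other;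
  moving the traced point from \<open>d\<close> to \<open>q\<close> does not change this.\<close>

lemma isotopy_traces_relative_log:
  fixes F G :: "real \<times> complex \<Rightarrow> complex"
  assumes F: "continuous_on ({0..1} \<times> UNIV) F" "\<And>t. t \<in> {0..1} \<Longrightarrow> inj (\<lambda>z. F (t, z))"
    and G: "continuous_on ({0..1} \<times> UNIV) G" "\<And>t. t \<in> {0..1} \<Longrightarrow> inj (\<lambda>z. G (t, z))"
    and FG: "\<And>z. F (0, z) = G (0, z)" "\<And>z. F (1, z) = G (1, z)"
    and b: "\<And>t. t \<in> {0..1} \<Longrightarrow> F (t, b) = b" "\<And>t. t \<in> {0..1} \<Longrightarrow> G (t, b) = b"
    and d: "\<And>t. t \<in> {0..1} \<Longrightarrow> F (t, d) = d" "\<And>t. t \<in> {0..1} \<Longrightarrow> G (t, d) = d"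
    and "d \<noteq> b" "q \<noteq> b"
  obtains L where "continuous_on {0..1} L" "L 0 = 0" "L 1 = 0"
    "\<And>t. t \<in> {0..1} \<Longrightarrow> F (t, q) - b = (G (t, q) - b) * exp (L t)"
proof -
  have "path_connected (- {b})"
    by (simp add: path_connected_punctured_universe)
  then obtain z where z: "path z" "path_image z \<subseteq> - {b}" "pathstart z = q" "pathfinish z = d"
    using \<open>d \<noteq> b\<close> \<open>q \<noteq> b\<close> unfolding path_connected_def by (metis ComplI empty_iff insert_iff)
  then have cz: "continuous_on {0..1} z" and zb: "\<And>s. s \<in> {0..1} \<Longrightarrow> z s \<noteq> b"
    by (auto simp: path_def path_image_def)
  have z01: "z 0 = q" "z 1 = d"
    using z by (auto simp: pathstart_def pathfinish_def)
  let ?I = "{0..1::real} \<times> {0..1::real}"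
  have Fb: "F (t, z s) \<noteq> b" and Gb: "G (t, z s) \<noteq> b" if "t \<in> {0..1}" "s \<in> {0..1}" for t s
    using zb [OF that(2)] injD [OF F(2) [OF that(1)], of "z s" b] injD [OF G(2) [OF that(1)], of "z s" b]
      b [OF that(1)] by auto
  \<comment> \<open>The quotient compares the positions relative to \<open>b\<close> under the two
    isotopies, for all points of the path \<open>z\<close> from \<open>q\<close> to \<open>d\<close>
    at once. The square is contractible, so \<open>Q\<close> has a continuous logarithm
    \<open>E\<close>.\<close>
  define Q where "Q = (\<lambda>x. (F (fst x, z (snd x)) - b) / (G (fst x, z (snd x)) - b))"
  have "continuous_on ?I Q"
    unfolding Q_def using Gb
    by (intro continuous_intros continuous_on_compose2 [OF F(1)] continuous_on_compose2 [OF G(1)]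
        continuous_on_compose2 [OF cz]) auto
  moreover have "contractible ?I"
    by (intro convex_imp_contractible convex_Times) auto
  moreover have "Q x \<noteq> 0" if "x \<in> ?I" for x
    using that Fb [of "fst x" "snd x"] Gb [of "fst x" "snd x"] by (auto simp: Q_def)
  ultimately obtain E where E: "continuous_on ?I E" "\<And>x. x \<in> ?I \<Longrightarrow> Q x = exp (E x)"
    using continuous_logarithm_on_contractible by metis
  have side: "E x = E y" if "connected T" "T \<subseteq> ?I" "\<And>x. x \<in> T \<Longrightarrow> Q x = 1" "x \<in> T" "y \<in> T" for T x y
  proof (rule exp_eq_1_imp_constant_on [of T E])
    show "continuous_on T E"
      using E(1) that(2) by (rule continuous_on_subset)
    show "exp (E w) = 1" if "w \<in> T" for w
      using E(2) [of w] \<open>T \<subseteq> ?I\<close> that \<open>\<And>x. x \<in> T \<Longrightarrow> Q x = 1\<close> by force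
  qed (use that in auto)
  have Q1: "Q (0, s) = 1" "Q (1, s) = 1" if "s \<in> {0..1}" for s
    using FG Gb [of 0 s] Gb [of 1 s] that by (auto simp: Q_def)
  \<comment> \<open>On three sides of the square \<open>Q\<close> is 1: at times 0 and 1 because the
    isotopies agree there, and along \<open>d\<close> because both fix it. Going round these sides
    shows that \<open>E\<close> has the same value at both ends of the fourth side, which belongs to
    \<open>q\<close>.\<close>
  have "E (0, 0) = E (0, 1)"
    using Q1 by (intro side [of "{0} \<times> {0..1}"]) (auto simp: connected_Times)
  moreover have "E (0, 1) = E (1, 1)"
    using d \<open>d \<noteq> b\<close> by (intro side [of "{0..1} \<times> {1}"]) (auto simp: connected_Times Q_def z01)
  moreover have "E (1, 1) = E (1, 0)"
    using Q1 by (intro side [of "{1} \<times> {0..1}"]) (auto simp: connected_Times)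
  ultimately have E10: "E (1, 0) = E (0, 0)" by simp
  have E00: "exp (E (0, 0)) = 1"
    using E(2) [of "(0, 0)"] Q1 [of 0] by simp
  show ?thesis
  proof (rule that [of "\<lambda>t. E (t, 0) - E (0, 0)"])
    show "continuous_on {0..1} (\<lambda>t. E (t, 0) - E (0, 0))"
      by (intro continuous_intros continuous_on_compose2 [OF E(1)]) auto
    show "F (t, q) - b = (G (t, q) - b) * exp (E (t, 0) - E (0, 0))" if "t \<in> {0..1}" for t
      using E(2) [of "(t, 0)"] that Gb [of t 0] by (simp add: exp_diff E00 Q_def z01 field_simps)
  qed (auto simp: E10)
qed

section \<open>Embeddings of the plane that avoid given points\<close>

lemma radial_squeeze_exists:
  fixes R :: real
  assumes "0 < R"
  obtains s :: "complex \<Rightarrow> complex" where "continuous_on UNIV s" "inj s"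
    "\<And>z. norm z \<le> R \<Longrightarrow> s z = z" "\<And>z. norm (s z) < R + 1"
proof -
  \<comment> \<open>The radial profile: the identity up to \<open>R\<close>, and beyond it the
    excess \<open>x - R\<close> is compressed increasingly into an interval of length 1.\<close>
  define k where "k = (\<lambda>x::real. if x \<le> R then x else R + (x - R) / (1 + (x - R)))"
  have k: "k x < k y" if "0 \<le> x" "x < y" for x y
  proof -
    have "(x - R) / (1 + (x - R)) < (y - R) / (1 + (y - R))" if "R < x"
      using that \<open>x < y\<close> by (simp add: divide_simps) (simp add: algebra_simps)
    moreover have "0 < (y - R) / (1 + (y - R))" if "R < y"
      using that by simp
    ultimately show ?thesis
      unfolding k_def using that by (smt (verit))
  qed
  have k1: "k x < R + 1" for x
    by (auto simp: k_def divide_simps algebra_simps)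
  have k0: "0 < k x" if "0 < x" for x
    using k [of 0 x] that \<open>0 < R\<close> by (simp add: k_def)
  \<comment> \<open>The scaling factor \<open>k x / x\<close>, with the value 1 on all of
    \<open>x \<le> R\<close>, so that nothing is divided by 0 at the origin.\<close>
  define l where "l = (\<lambda>x::real. if x \<le> R then 1 else (R + (x - R) / (1 + (x - R))) / x)"
  have "continuous_on ({..R} \<union> {R..}) l"
    unfolding l_def using \<open>0 < R\<close>
    by (intro continuous_on_cases continuous_intros) auto
  moreover have "{..R} \<union> {R..} = UNIV" by auto
  ultimately have cl: "continuous_on UNIV l" by simp
  have lk: "k x = l x * x" if "0 \<le> x" for x
    using \<open>0 < R\<close> by (auto simp: k_def l_def)
  have l0: "0 < l x" if "0 \<le> x" for x
    using k0 [of x] lk [OF that] that \<open>0 < R\<close>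
    by (cases "x = 0") (auto simp: l_def zero_less_mult_iff)
  define s where "s = (\<lambda>z::complex. l (norm z) *\<^sub>R z)"
  have ns: "norm (s z) = k (norm z)" for z
    using l0 [of "norm z"] by (simp add: s_def lk)
  show ?thesis
  proof (rule that [of s])
    show "continuous_on UNIV s"
      unfolding s_def by (intro continuous_intros continuous_on_compose2 [OF cl]) auto
    show "inj s"
    proof (rule injI)
      fix x y assume xy: "s x = s y"
      then have "k (norm x) = k (norm y)"
        by (metis ns)
      then have "norm x = norm y"
        using k [of "norm x" "norm y"] k [of "norm y" "norm x"] by force
      then show "x = y"
        using xy l0 [of "norm x"] by (simp add: s_def)
    qed
    show "s z = z" if "norm z \<le> R" for z
      using that by (simp add: s_def l_def)
    show "norm (s z) < R + 1" for z
      by (simp add: ns k1)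
  qed
qed

text \<open>Conjugate a radial squeeze of the plane into a disc by a homeomorphism, supported in \<open>W\<close>, that
  moves \<open>A\<close> out of that disc.\<close>

lemma embedding_avoiding_exists:
  fixes W :: "complex set"
  assumes W: "open W" "connected W" "bounded (- W)" and A: "finite A" "A \<subseteq> W"
  obtains r where "continuous_on UNIV r" "inj r" "\<And>z. z \<notin> W \<Longrightarrow> r z = z" "range r \<subseteq> - A"
proof -
  obtain R where R: "0 < R" "\<And>z. z \<notin> W \<Longrightarrow> norm z \<le> R"
    using W(3) by (auto simp: bounded_pos)
  obtain e :: "complex \<Rightarrow> nat" where e: "inj_on e A"
    using finite_imp_inj_to_nat_seg [OF A(1)] by blast
  \<comment> \<open>Targets for the points of \<open>A\<close>: distinct because \<open>e\<close> is
    injective on \<open>A\<close>, and of norm at least \<open>R + 1\<close>, hence in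
    \<open>W\<close> and outside the open disc that contains the range of the squeeze.\<close>
  define y where "y = (\<lambda>a. complex_of_real (R + 1 + real (e a)))"
  have ny: "R + 1 \<le> norm (y a)" for a
    using R(1) unfolding y_def norm_of_real by simp
  have yW: "y a \<in> W" for a
    using R(2) [of "y a"] ny [of a] by fastforce
  have pw: "pairwise (\<lambda>i j. i \<noteq> j \<and> y i \<noteq> y j) A"
    using e by (auto simp: pairwise_def y_def inj_on_def simp flip: of_real_add of_nat_add)
  have aff: "UNIV \<subseteq> affine hull W"
    using W(1) yW by (metis affine_hull_open empty_iff order_refl)
  obtain f g where fg: "homeomorphism UNIV UNIV f g" "\<And>a. a \<in> A \<Longrightarrow> f a = y a"
      "{x. \<not> (f x = x \<and> g x = x)} \<subseteq> W"
    by (rule homeomorphism_moving_points_exists [of W UNIV A "\<lambda>a. a" y])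
      (use W A pw yW aff in auto)
  obtain s :: "complex \<Rightarrow> complex" where s: "continuous_on UNIV s" "inj s"
    "\<And>z. norm z \<le> R \<Longrightarrow> s z = z" "\<And>z. norm (s z) < R + 1"
    using radial_squeeze_exists [OF R(1)] by blast
  have cf: "continuous_on UNIV f" "continuous_on UNIV g" and gf: "\<And>x. g (f x) = x" "\<And>x. f (g x) = x"
    using fg(1) by (auto simp: homeomorphism_def)
  show ?thesis
  proof (rule that [of "g \<circ> s \<circ> f"])
    show "continuous_on UNIV (g \<circ> s \<circ> f)"
      using cf s(1) by (metis continuous_on_compose continuous_on_subset subset_UNIV)
    show "inj (g \<circ> s \<circ> f)"
    proof (intro inj_compose s(2))
      show "inj g" "inj f"
        using gf by (metis injI)+
    qed
    show "(g \<circ> s \<circ> f) z = z" if "z \<notin> W" for z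
    proof -
      have "f z = z" "g z = z"
        using fg(3) that by auto
      then show ?thesis
        using R(2) [OF that] s(3) by simp
    qed
    have "g (s (f z)) \<notin> A" for z
    proof
      assume "g (s (f z)) \<in> A"
      then have "f (g (s (f z))) = y (g (s (f z)))"
        using fg(2) by blast
      then have "R + 1 \<le> norm (s (f z))"
        using gf ny by metis
      then show False using s(4) [of "f z"] by simp
    qed
    then show "range (g \<circ> s \<circ> f) \<subseteq> - A" by auto
  qed
qed

text \<open>Composing the homotopy with an embedding \<open>r\<close> that is the identity off
  \<open>W\<close> and misses \<open>A\<close> pushes it off \<open>A\<close>. The two paths do not
  meet \<open>W\<close>, so \<open>r\<close> leaves them alone.\<close>

lemma homotopic_paths_avoid_more:
  fixes W :: "complex set"
  assumes W: "open W" "connected W" "bounded (- W)" and A: "finite A" "A \<subseteq> W"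
    and B: "B \<inter> W = {}" and l: "path_image l \<inter> W = {}" "path_image l' \<inter> W = {}"
    and hom: "homotopic_paths (- B) l l'"
  shows "homotopic_paths (- (A \<union> B)) l l'"
proof -
  obtain r where r: "continuous_on UNIV r" "inj r" "\<And>z. z \<notin> W \<Longrightarrow> r z = z" "range r \<subseteq> - A"
    using embedding_avoiding_exists [OF W A] by blast
  \<comment> \<open>A value \<open>r z\<close> in \<open>B\<close> is off \<open>W\<close> and thus
    fixed by \<open>r\<close>; injectivity then gives \<open>z = r z\<close>.\<close>
  have "r z \<notin> B" if "z \<notin> B" for z
  proof
    assume rz: "r z \<in> B"
    then have "r (r z) = r z"
      using B r(3) by auto
    then show False using injD [OF r(2)] rz that by metis
  qed
  then have "r \<in> - B \<rightarrow> - (A \<union> B)"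
    using r(4) by blast
  then have "homotopic_paths (- (A \<union> B)) (r \<circ> l) (r \<circ> l')"
    using r(1) by (intro homotopic_paths_continuous_image [OF hom]) (auto intro: continuous_on_subset)
  moreover have "homotopic_paths (- (A \<union> B)) l (r \<circ> l)" "homotopic_paths (- (A \<union> B)) l' (r \<circ> l')"
  proof -
    have "r (l t) = l t" "r (l' t) = l' t" if "t \<in> {0..1}" for t
      using that l by (auto intro!: r(3) simp: path_image_def disjoint_iff)
    moreover have "path_image l \<subseteq> - (A \<union> B)" "path_image l' \<subseteq> - (A \<union> B)"
      using homotopic_paths_imp_subset [OF hom] l A(2) by auto
    ultimately show "homotopic_paths (- (A \<union> B)) l (r \<circ> l)" "homotopic_paths (- (A \<union> B)) l' (r \<circ> l')"
      using homotopic_paths_imp_path [OF hom] by (auto intro!: homotopic_paths_eq)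
  qed
  ultimately show ?thesis
    by (meson homotopic_paths_sym homotopic_paths_trans)
qed

section \<open>Point pushing\<close>

text \<open>Translation by \<open>v - u\<close>, damped by a tent function that is 1 at
  \<open>u\<close> and 0 from distance \<open>\<epsilon>\<close> on. The tent has Lipschitz constant
  \<open>1 / \<epsilon>\<close>, which is what makes short pushes invertible.\<close>

definition point_push :: "real \<Rightarrow> complex \<Rightarrow> complex \<Rightarrow> complex \<Rightarrow> complex" where
  "point_push \<epsilon> u v z = z + max 0 (1 - norm (z - u) / \<epsilon>) *\<^sub>R (v - u)"

lemma point_push_same [simp]: "point_push \<epsilon> u u z = z"
  by (simp add: point_push_def)

lemma point_push_center [simp]: "point_push \<epsilon> u v u = v"
  by (simp add: point_push_def)

lemma point_push_outside:
  assumes "0 < \<epsilon>" "\<epsilon> \<le> norm (z - u)"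
  shows "point_push \<epsilon> u v z = z"
  using assms by (simp add: point_push_def max_def)

text \<open>A preimage of \<open>w\<close> is a fixed point of
  \<open>x \<mapsto> w - \<phi> x *\<^sub>R (v - u)\<close>, which is a contraction with constant
  \<open>norm (v - u) / \<epsilon>\<close>; Banach's theorem gives exactly one.\<close>

lemma bij_point_push:
  assumes "norm (v - u) < \<epsilon>"
  shows "bij (point_push \<epsilon> u v)"
proof -
  have \<epsilon>: "0 < \<epsilon>"
    using assms norm_ge_zero order_le_less_trans by blast
  define \<phi> where "\<phi> = (\<lambda>z. max 0 (1 - norm (z - u) / \<epsilon>))"
  define c where "c = norm (v - u) / \<epsilon>"
  have c: "0 \<le> c" "c < 1"
    using \<epsilon> assms by (auto simp: c_def)
  have \<phi>: "\<bar>\<phi> x - \<phi> z\<bar> \<le> norm (x - z) / \<epsilon>" for x z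
  proof -
    have "\<bar>\<phi> x - \<phi> z\<bar> \<le> \<bar>norm (x - u) / \<epsilon> - norm (z - u) / \<epsilon>\<bar>"
      unfolding \<phi>_def max_def by (smt (verit))
    also have "\<dots> = \<bar>norm (x - u) - norm (z - u)\<bar> / \<epsilon>"
      using \<epsilon> by (simp flip: diff_divide_distrib)
    also have "\<dots> \<le> norm (x - z) / \<epsilon>"
      using \<epsilon> norm_triangle_ineq3 [of "x - u" "z - u"] by (simp add: divide_right_mono)
    finally show ?thesis .
  qed
  have contr: "dist (w - \<phi> x *\<^sub>R (v - u)) (w - \<phi> z *\<^sub>R (v - u)) \<le> c * dist x z" for w x z
  proof -
    have "dist (w - \<phi> x *\<^sub>R (v - u)) (w - \<phi> z *\<^sub>R (v - u)) = norm ((\<phi> z - \<phi> x) *\<^sub>R (v - u))"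
      by (simp add: dist_norm algebra_simps)
    also have "\<dots> = \<bar>\<phi> x - \<phi> z\<bar> * norm (v - u)"
      by (simp add: abs_minus_commute)
    also have "\<dots> \<le> norm (x - z) / \<epsilon> * norm (v - u)"
      by (intro mult_right_mono \<phi>) auto
    finally show ?thesis
      by (simp add: c_def dist_norm field_simps)
  qed
  have "\<exists>!x. w - \<phi> x *\<^sub>R (v - u) = x" for w
    by (rule banach_fix_type [OF c]) (use contr in blast)
  moreover have "w - \<phi> x *\<^sub>R (v - u) = x \<longleftrightarrow> w = point_push \<epsilon> u v x" for w x
    by (auto simp: point_push_def \<phi>_def algebra_simps)
  ultimately show ?thesis
    unfolding bij_iff by metis
qed

text \<open>A loop of plane homeomorphisms based at the identity, so that composing it with an
  isotopy keeps the initial and final maps. The common radius \<open>R\<close> lets the loop extend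
  over the point at infinity of the sphere.\<close>

definition isotopy_carries :: "complex set \<Rightarrow> (real \<Rightarrow> complex) \<Rightarrow> (real \<Rightarrow> complex) \<Rightarrow> bool" where
  "isotopy_carries Z \<alpha> \<beta> \<longleftrightarrow>
     (\<exists>\<Phi> R. continuous_on ({0..1} \<times> UNIV) \<Phi> \<and>
        (\<forall>t\<in>{0..1}. bij (\<lambda>z. \<Phi> (t, z)) \<and> \<Phi> (t, \<alpha> t) = \<beta> t \<and>
           (\<forall>z. z \<in> Z \<or> R < norm z \<longrightarrow> \<Phi> (t, z) = z)) \<and>
        (\<forall>z. \<Phi> (0, z) = z \<and> \<Phi> (1, z) = z))"

lemma isotopy_carries_refl: "isotopy_carries Z \<alpha> \<alpha>"
  unfolding isotopy_carries_def
  by (rule exI [of _ snd]) (auto intro!: continuous_intros simp: bij_def inj_on_def)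

lemma isotopy_carries_trans:
  assumes "isotopy_carries Z \<alpha> \<beta>" "isotopy_carries Z \<beta> \<gamma>"
  shows "isotopy_carries Z \<alpha> \<gamma>"
proof -
  obtain \<Phi> R where \<Phi>: "continuous_on ({0..1} \<times> UNIV) \<Phi>"
      "\<And>t. t \<in> {0..1} \<Longrightarrow> bij (\<lambda>z. \<Phi> (t, z))" "\<And>t. t \<in> {0..1} \<Longrightarrow> \<Phi> (t, \<alpha> t) = \<beta> t"
      "\<And>t z. t \<in> {0..1} \<Longrightarrow> z \<in> Z \<or> R < norm z \<Longrightarrow> \<Phi> (t, z) = z" "\<And>z. \<Phi> (0, z) = z" "\<And>z. \<Phi> (1, z) = z"
    using assms(1) unfolding isotopy_carries_def by blast
  obtain \<Psi> R' where \<Psi>: "continuous_on ({0..1} \<times> UNIV) \<Psi>"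
      "\<And>t. t \<in> {0..1} \<Longrightarrow> bij (\<lambda>z. \<Psi> (t, z))" "\<And>t. t \<in> {0..1} \<Longrightarrow> \<Psi> (t, \<beta> t) = \<gamma> t"
      "\<And>t z. t \<in> {0..1} \<Longrightarrow> z \<in> Z \<or> R' < norm z \<Longrightarrow> \<Psi> (t, z) = z" "\<And>z. \<Psi> (0, z) = z" "\<And>z. \<Psi> (1, z) = z"
    using assms(2) unfolding isotopy_carries_def by blast
  define \<Theta> where "\<Theta> = (\<lambda>x. \<Psi> (fst x, \<Phi> x))"
  have "continuous_on ({0..1} \<times> UNIV) \<Theta>"
    unfolding \<Theta>_def by (intro continuous_on_compose2 [OF \<Psi>(1)] continuous_intros \<Phi>(1)) auto
  moreover have "bij (\<lambda>z. \<Theta> (t, z))" if "t \<in> {0..1}" for t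
    using bij_comp [OF \<Phi>(2) [OF that] \<Psi>(2) [OF that]] by (simp add: \<Theta>_def comp_def)
  ultimately show ?thesis
    unfolding isotopy_carries_def
    by (intro exI [of _ \<Theta>] exI [of _ "max R R'"]) (use \<Phi>(3-6) \<Psi>(3-6) in \<open>auto simp: \<Theta>_def\<close>)
qed

text \<open>At time \<open>t\<close>, push \<open>\<alpha> t\<close> straight to
  \<open>\<beta> t\<close>. The push is supported in the disc of radius \<open>\<epsilon>\<close>
  about \<open>\<alpha> t\<close>, whose interior misses \<open>Z\<close>, and it is trivial at
  times 0 and 1 since the paths share their endpoints.\<close>

lemma isotopy_carries_near:
  assumes \<alpha>: "continuous_on {0..1} \<alpha>" and \<beta>: "continuous_on {0..1} \<beta>"
    and ends: "\<alpha> 0 = \<beta> 0" "\<alpha> 1 = \<beta> 1"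
    and near: "\<And>t. t \<in> {0..1} \<Longrightarrow> norm (\<beta> t - \<alpha> t) < \<epsilon>"
    and away: "\<And>t z. t \<in> {0..1} \<Longrightarrow> z \<in> Z \<Longrightarrow> \<epsilon> \<le> norm (z - \<alpha> t)"
  shows "isotopy_carries Z \<alpha> \<beta>"
proof -
  have \<epsilon>: "0 < \<epsilon>"
    using near [of 0] norm_ge_zero order_le_less_trans by (metis atLeastAtMost_iff order_refl zero_le_one)
  obtain R where R: "\<And>t. t \<in> {0..1} \<Longrightarrow> norm (\<alpha> t) \<le> R"
    using compact_imp_bounded [OF compact_continuous_image [OF \<alpha>]] by (auto simp: bounded_iff simp del: atLeastAtMost_iff)
  define \<Phi> where "\<Phi> = (\<lambda>x. point_push \<epsilon> (\<alpha> (fst x)) (\<beta> (fst x)) (snd x))"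
  have "continuous_on ({0..1} \<times> UNIV) \<Phi>"
    unfolding \<Phi>_def point_push_def using \<epsilon>
    by (intro continuous_intros continuous_on_compose2 [OF \<alpha>] continuous_on_compose2 [OF \<beta>]) auto
  moreover have "\<Phi> (t, z) = z" if "t \<in> {0..1}" "z \<in> Z \<or> R + \<epsilon> < norm z" for t z
  proof -
    have "\<epsilon> \<le> norm (z - \<alpha> t)"
      using that away R [of t] norm_triangle_ineq2 [of z "\<alpha> t"] by fastforce
    then show ?thesis
      using \<epsilon> by (simp add: \<Phi>_def point_push_outside)
  qed
  moreover have "bij (\<lambda>z. \<Phi> (t, z))" if "t \<in> {0..1}" for t
    using bij_point_push [OF near [OF that]] by (simp add: \<Phi>_def)
  ultimately show ?thesis
    unfolding isotopy_carries_def
    by (intro exI [of _ \<Phi>] exI [of _ "R + \<epsilon>"]) (auto simp: \<Phi>_def ends)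
qed

text \<open>The compact image of the homotopy has a distance \<open>\<epsilon>\<close> from
  \<open>Z\<close>. By uniform continuity the homotopy splits into \<open>Suc N\<close> stages that
  each move points by less than \<open>\<epsilon>\<close>; each stage is realised by point pushes,
  and these are composed.\<close>

lemma homotopic_paths_imp_isotopy_carries:
  assumes "closed Z" and hom: "homotopic_paths (- Z) \<alpha> \<beta>"
  shows "isotopy_carries Z \<alpha> \<beta>"
proof -
  let ?I = "{0..1::real} \<times> {0..1::real}"
  obtain h where h: "continuous_on ?I h" "h ` ?I \<subseteq> - Z"
      "\<And>t. t \<in> {0..1} \<Longrightarrow> h (0, t) = \<alpha> t" "\<And>t. t \<in> {0..1} \<Longrightarrow> h (1, t) = \<beta> t"
      and ends: "\<And>s. s \<in> {0..1} \<Longrightarrow> h (s, 0) = \<alpha> 0" "\<And>s. s \<in> {0..1} \<Longrightarrow> h (s, 1) = \<alpha> 1"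
    using hom unfolding homotopic_paths by (auto simp: pathstart_def pathfinish_def image_subset_iff_funcset)
  have I: "compact ?I"
    by (intro compact_Times) auto
  have "compact (h ` ?I)"
    using h(1) I by (rule compact_continuous_image)
  then obtain \<epsilon> where \<epsilon>: "0 < \<epsilon>" "\<And>x z. x \<in> ?I \<Longrightarrow> z \<in> Z \<Longrightarrow> \<epsilon> \<le> dist (h x) z"
    using separate_compact_closed [of "h ` ?I" Z] \<open>closed Z\<close> h(2) by blast
  obtain \<delta> where \<delta>: "0 < \<delta>" "\<And>x x'. x \<in> ?I \<Longrightarrow> x' \<in> ?I \<Longrightarrow> dist x' x < \<delta> \<Longrightarrow> dist (h x') (h x) < \<epsilon>"
    using compact_uniformly_continuous [OF h(1) I] \<epsilon>(1) unfolding uniformly_continuous_on_def by metis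
  obtain N where N: "inverse (real (Suc N)) < \<delta>"
    using \<delta>(1) reals_Archimedean by blast
  have "isotopy_carries Z \<alpha> (\<lambda>t. h (real k / real (Suc N), t))" if "k \<le> Suc N" for k
    using that
  proof (induction k)
    case 0
    have "isotopy_carries Z \<alpha> (\<lambda>t. h (0, t))"
      using isotopy_carries_refl [of Z \<alpha>] h(3) unfolding isotopy_carries_def by simp
    then show ?case by simp
  next
    case (Suc k)
    let ?s = "\<lambda>k. real k / real (Suc N)"
    have s: "?s k \<in> {0..1}" "?s (Suc k) \<in> {0..1}"
      using Suc.prems by (auto simp: field_simps)
    have "?s (Suc k) - ?s k = inverse (real (Suc N))"
      by (simp add: field_simps)
    then have d: "dist (?s (Suc k)) (?s k) < \<delta>"
      using N by (simp add: dist_real_def)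
    have "isotopy_carries Z (\<lambda>t. h (?s k, t)) (\<lambda>t. h (?s (Suc k), t))"
    proof (rule isotopy_carries_near [where \<epsilon> = \<epsilon>])
      show "norm (h (?s (Suc k), t) - h (?s k, t)) < \<epsilon>" if "t \<in> {0..1}" for t
        using \<delta>(2) [of "(?s k, t)" "(?s (Suc k), t)"] s d that by (auto simp: dist_norm dist_prod_def)
      show "\<epsilon> \<le> norm (z - h (?s k, t))" if "t \<in> {0..1}" "z \<in> Z" for t z
        using \<epsilon>(2) [of "(?s k, t)" z] s that by (auto simp: dist_norm norm_minus_commute)
    qed (use s ends in \<open>auto intro!: continuous_on_compose2 [OF h(1)] continuous_intros\<close>)
    then show ?case
      using Suc isotopy_carries_trans by (metis Suc_leD)
  qed
  from this [of "Suc N"] have "isotopy_carries Z \<alpha> (\<lambda>t. h (1, t))"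
    by simp
  then show ?thesis
    using h(4) unfolding isotopy_carries_def by simp
qed

section \<open>Traces of isotopies of the plane\<close>

text \<open>Moving the traced point from \<open>p\<close> to a point \<open>q\<close> near \<open>b\<close> deforms both traces into loops that differ
  only in their part near \<open>b\<close>, where they agree up to homotopy. The trace under \<open>G\<close> is constant, and the
  deformed loop avoids \<open>W\<close>, so that it remains null-homotopic when the points of \<open>A\<close> are removed.\<close>

lemma isotopy_trace_nullhomotopic:
  fixes F G :: "real \<times> complex \<Rightarrow> complex"
  assumes F: "continuous_on ({0..1} \<times> UNIV) F" "\<And>t. t \<in> {0..1} \<Longrightarrow> inj (\<lambda>z. F (t, z))"
    and G: "continuous_on ({0..1} \<times> UNIV) G" "\<And>t. t \<in> {0..1} \<Longrightarrow> inj (\<lambda>z. G (t, z))"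
    and FG: "\<And>z. F (0, z) = G (0, z)" "\<And>z. F (1, z) = z" "\<And>z. G (1, z) = z"
    and fixF: "\<And>t z. t \<in> {0..1} \<Longrightarrow> z \<in> A \<union> B \<union> {d} \<Longrightarrow> F (t, z) = z"
    and fixG: "\<And>t z. t \<in> {0..1} \<Longrightarrow> z \<in> B \<union> {d, p} \<Longrightarrow> G (t, z) = z"
    and AB: "finite A" "finite B" and bd: "b \<in> B" "d \<noteq> b"
    and W: "open W" "connected W" "bounded (- W)" "A \<subseteq> W" "B \<inter> W = {}"
    and U: "open U" "connected U" "p \<in> U" "b \<in> U" "p \<notin> B" "U \<inter> W = {}" "(\<lambda>z. F (0, z)) ` U \<inter> W = {}"
  shows "homotopic_paths (- (A \<union> B)) (\<lambda>t. F (t, p)) (linepath p p)"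
proof -
  have "open (U - (B - {b}))"
    using AB U by (intro open_Diff finite_imp_closed) auto
  \<comment> \<open>A ball inside \<open>U\<close> whose only point of \<open>B\<close> is
    \<open>b\<close>.\<close>
  then obtain \<rho> where \<rho>: "0 < \<rho>" "ball b \<rho> \<subseteq> U - (B - {b})"
    using U bd by (meson DiffI Diff_iff insertI1 openE)
  \<comment> \<open>As \<open>b\<close> stays fixed, uniform continuity keeps points close to
    \<open>b\<close> within \<open>\<rho>\<close> of it throughout the isotopy.\<close>
  have near: "\<exists>\<delta>>0. \<forall>t\<in>{0..1}. \<forall>z. dist z b < \<delta> \<longrightarrow> dist (H (t, z)) b < \<rho>"
    if H: "continuous_on ({0..1} \<times> UNIV) H" "\<And>t. t \<in> {0..1} \<Longrightarrow> H (t, b) = b"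
    for H :: "real \<times> complex \<Rightarrow> complex"
  proof -
    have "uniformly_continuous_on ({0..1} \<times> cball b 1) H"
      by (intro compact_uniformly_continuous continuous_on_subset [OF H(1)] compact_Times) auto
    then obtain \<delta> where \<delta>: "0 < \<delta>" "\<And>x x'. x \<in> {0..1} \<times> cball b 1 \<Longrightarrow> x' \<in> {0..1} \<times> cball b 1 \<Longrightarrow>
        dist x' x < \<delta> \<Longrightarrow> dist (H x') (H x) < \<rho>"
      using \<rho>(1) unfolding uniformly_continuous_on_def by metis
    have "dist (H (t, z)) b < \<rho>" if "t \<in> {0..1}" "dist z b < min \<delta> 1" for t z
      using \<delta>(2) [of "(t, b)" "(t, z)"] that H(2) [OF that(1)] by (auto simp: dist_prod_def dist_commute)
    then show ?thesis
      using \<delta>(1) by (intro exI [of _ "min \<delta> 1"]) auto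
  qed
  obtain \<delta>1 where \<delta>1: "0 < \<delta>1" "\<And>t z. t \<in> {0..1} \<Longrightarrow> dist z b < \<delta>1 \<Longrightarrow> dist (F (t, z)) b < \<rho>"
    using near [OF F(1)] fixF bd by blast
  obtain \<delta>2 where \<delta>2: "0 < \<delta>2" "\<And>t z. t \<in> {0..1} \<Longrightarrow> dist z b < \<delta>2 \<Longrightarrow> dist (G (t, z)) b < \<rho>"
    using near [OF G(1)] fixG bd by blast
  define e where "e = min \<rho> (min \<delta>1 \<delta>2) / 2"
  define q where "q = b + complex_of_real e"
  have e: "0 < e" "e < \<rho>" "e < \<delta>1" "e < \<delta>2"
    using \<rho> \<delta>1 \<delta>2 by (auto simp: e_def)
  have q: "dist q b = e" "q \<noteq> b"
    using e by (auto simp: q_def dist_norm)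
  then have qU: "q \<in> U - B"
    using \<rho>(2) e by (force simp: dist_commute)
  have "path_connected (U - B)"
    using U AB by (intro path_connected_open_diff_countable countable_finite) auto
  then obtain \<sigma> where \<sigma>: "path \<sigma>" "path_image \<sigma> \<subseteq> U - B" "pathstart \<sigma> = p" "pathfinish \<sigma> = q"
    using qU U unfolding path_connected_def by (metis DiffI)
  then have c\<sigma>: "continuous_on {0..1} \<sigma>" and \<sigma>U: "\<And>s. s \<in> {0..1} \<Longrightarrow> \<sigma> s \<in> U - B"
      and \<sigma>01: "\<sigma> 0 = p" "\<sigma> 1 = q"
    by (auto simp: path_def path_image_def pathstart_def pathfinish_def image_subset_iff)
  define f where "f = (\<lambda>s. F (0, \<sigma> s))"
  define m m' where "m = (\<lambda>t. F (t, q))" and "m' = (\<lambda>t. G (t, q))"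
  \<comment> \<open>The two traces are compared along \<open>\<sigma>\<close>. The final map is the
    identity, so the return path is \<open>\<sigma>\<close> itself; the outward path
    \<open>f\<close> is the same for \<open>F\<close> and \<open>G\<close>, as they start at the
    same map.\<close>
  have homF: "homotopic_paths (- (A \<union> B)) (\<lambda>t. F (t, p)) (f +++ m +++ reversepath \<sigma>)"
  proof -
    \<comment> \<open>A value in \<open>A \<union> B\<close> is fixed by the injective map at time
      \<open>t\<close>, so it would equal \<open>\<sigma> s\<close>, which lies in
      \<open>U - B\<close> and hence not in \<open>A\<close> either.\<close>
    have "F (t, \<sigma> s) \<notin> A \<union> B" if "t \<in> {0..1}" "s \<in> {0..1}" for t s
    proof
      assume "F (t, \<sigma> s) \<in> A \<union> B"
      then have "F (t, F (t, \<sigma> s)) = F (t, \<sigma> s)"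
        using fixF that by blast
      then have "F (t, \<sigma> s) = \<sigma> s"
        using injD [OF F(2) [OF that(1)]] by blast
      with \<open>F (t, \<sigma> s) \<in> A \<union> B\<close> show False
        using \<sigma>U [OF that(2)] U W by auto
    qed
    then have "homotopic_paths (- (A \<union> B)) (\<lambda>t. F (t, \<sigma> 0))
        ((\<lambda>s. F (0, \<sigma> s)) +++ (\<lambda>t. F (t, \<sigma> 1)) +++ reversepath (\<lambda>s. F (1, \<sigma> s)))"
      using homotopic_paths_square [of "\<lambda>x. F (fst x, \<sigma> (snd x))" "- (A \<union> B)"]
      by (force intro!: continuous_on_compose2 [OF F(1)] continuous_on_compose2 [OF c\<sigma>] continuous_intros)
    then show ?thesis
      by (simp add: FG \<sigma>01 f_def m_def)
  qed
  \<comment> \<open>Only \<open>B\<close> is avoided here, since \<open>G\<close> may move points of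
    \<open>A\<close>.\<close>
  have homG: "homotopic_paths (- B) (\<lambda>t. G (t, p)) (f +++ m' +++ reversepath \<sigma>)"
  proof -
    have "G (t, \<sigma> s) \<notin> B" if "t \<in> {0..1}" "s \<in> {0..1}" for t s
    proof
      assume "G (t, \<sigma> s) \<in> B"
      then have "G (t, G (t, \<sigma> s)) = G (t, \<sigma> s)"
        using fixG that by blast
      then have "G (t, \<sigma> s) = \<sigma> s"
        using injD [OF G(2) [OF that(1)]] by blast
      with \<open>G (t, \<sigma> s) \<in> B\<close> show False
        using \<sigma>U [OF that(2)] by auto
    qed
    then have "homotopic_paths (- B) (\<lambda>t. G (t, \<sigma> 0))
        ((\<lambda>s. G (0, \<sigma> s)) +++ (\<lambda>t. G (t, \<sigma> 1)) +++ reversepath (\<lambda>s. G (1, \<sigma> s)))"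
      using homotopic_paths_square [of "\<lambda>x. G (fst x, \<sigma> (snd x))" "- B"]
      by (force intro!: continuous_on_compose2 [OF G(1)] continuous_on_compose2 [OF c\<sigma>] continuous_intros)
    then show ?thesis
      by (simp add: FG \<sigma>01 f_def m'_def)
  qed
  have m: "path m" "path_image m \<subseteq> ball b \<rho> - {b}"
  proof -
    show "path m"
      unfolding path_def m_def by (intro continuous_on_compose2 [OF F(1)] continuous_intros) auto
    have "F (t, q) \<noteq> b" "dist (F (t, q)) b < \<rho>" if "t \<in> {0..1}" for t
      using \<delta>1(2) [OF that] e q fixF [OF that, of b] bd injD [OF F(2) [OF that], of q b] by auto
    then show "path_image m \<subseteq> ball b \<rho> - {b}"
      unfolding path_image_def image_subset_iff m_def by (simp add: dist_commute)
  qed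
  have m': "path m'" "path_image m' \<subseteq> ball b \<rho> - {b}"
  proof -
    show "path m'"
      unfolding path_def m'_def by (intro continuous_on_compose2 [OF G(1)] continuous_intros) auto
    have "G (t, q) \<noteq> b" "dist (G (t, q)) b < \<rho>" if "t \<in> {0..1}" for t
      using \<delta>2(2) [OF that] e q fixG [OF that, of b] bd injD [OF G(2) [OF that], of q b] by auto
    then show "path_image m' \<subseteq> ball b \<rho> - {b}"
      unfolding path_image_def image_subset_iff m'_def by (simp add: dist_commute)
  qed
  obtain L where "continuous_on {0..1} L" "L 0 = 0" "L 1 = 0"
    "\<And>t. t \<in> {0..1} \<Longrightarrow> F (t, q) - b = (G (t, q) - b) * exp (L t)"
    by (rule isotopy_traces_relative_log [OF F G, of b d q]) (use FG fixF fixG bd q in auto)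
  then have "homotopic_paths (ball b \<rho> - {b}) m' m"
    using m m' by (intro homotopic_paths_punctured_ball [where L = L]) (auto simp: m_def m'_def)
  moreover have "ball b \<rho> - {b} \<subseteq> - B"
    using \<rho>(2) by auto
  ultimately have mm': "homotopic_paths (- B) m m'"
    using homotopic_paths_subset homotopic_paths_sym by blast
  have pf: "path f" "path_image f \<subseteq> - B" "pathfinish f = F (0, q)" "pathstart m = F (0, q)" "pathfinish m = q"
  proof -
    show "path f"
      unfolding path_def f_def by (intro continuous_on_compose2 [OF F(1)] c\<sigma> continuous_intros) auto
    show f: "pathfinish f = F (0, q)" "pathstart m = F (0, q)" "pathfinish m = q"
      by (auto simp: f_def m_def pathstart_def pathfinish_def \<sigma>01 FG)
    show "path_image f \<subseteq> - B"
      using homotopic_paths_imp_subset [OF homF] f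
      by (simp add: path_image_join \<sigma>)
  qed
  \<comment> \<open>Near \<open>b\<close> the trace \<open>m\<close> is exchanged for
    \<open>m'\<close>; the result is the deformed trace of \<open>p\<close> under \<open>G\<close>,
    which is constant.\<close>
  have "homotopic_paths (- B) (f +++ m +++ reversepath \<sigma>) (f +++ m' +++ reversepath \<sigma>)"
    using pf \<sigma> by (intro homotopic_paths_join mm') auto
  also have "homotopic_paths (- B) (f +++ m' +++ reversepath \<sigma>) (\<lambda>t. G (t, p))"
    using homG by (rule homotopic_paths_sym)
  also have "homotopic_paths (- B) (\<lambda>t. G (t, p)) (linepath p p)"
    using homotopic_paths_imp_path [OF homG] homotopic_paths_imp_subset [OF homG] fixG
    by (intro homotopic_paths_eq) auto
  finally have null: "homotopic_paths (- B) (f +++ m +++ reversepath \<sigma>) (linepath p p)" .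
  \<comment> \<open>All three pieces avoid \<open>W\<close>: \<open>f\<close> lies in the initial
    image of \<open>U\<close>, while \<open>m\<close> and \<open>\<sigma>\<close> lie in
    \<open>U\<close>.\<close>
  have "path_image f \<inter> W = {}"
    using U(7) \<sigma>U by (force simp: path_image_def f_def)
  moreover have "path_image m \<inter> W = {}"
    using m(2) \<rho>(2) U by blast
  moreover have "path_image \<sigma> \<inter> W = {}"
    using \<sigma> U by blast
  ultimately have "path_image (f +++ m +++ reversepath \<sigma>) \<inter> W = {}"
    using pf \<sigma> by (simp add: path_image_join Int_Un_distrib2)
  moreover have "path_image (linepath p p) \<inter> W = {}"
    using U by auto
  ultimately have "homotopic_paths (- (A \<union> B)) (f +++ m +++ reversepath \<sigma>) (linepath p p)"
    using homotopic_paths_avoid_more [OF W(1-3) AB(1) W(4,5)] null by blast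
  then show ?thesis
    using homF homotopic_paths_trans by blast
qed

section \<open>Nested Jordan curves\<close>

text \<open>A homeomorphism of the whole space permutes complementary components, and it preserves
  boundedness in both directions because closures of bounded sets are compact.\<close>

lemma inside_homeomorphism_image:
  fixes h :: "'a::euclidean_space \<Rightarrow> 'a"
  assumes h: "homeomorphism UNIV UNIV h k"
  shows "inside (h ` S) = h ` inside S"
proof -
  have hk: "continuous_on UNIV h" "continuous_on UNIV k" "\<And>x. k (h x) = x" "\<And>x. h (k x) = x"
    using h by (auto simp: homeomorphism_def)
  have bdd: "bounded (f ` T)" if "continuous_on UNIV f" "bounded T" for f :: "'a \<Rightarrow> 'a" and T
  proof -
    have "compact (f ` closure T)"
      using that by (intro compact_continuous_image) (auto intro: continuous_on_subset)
    then show ?thesis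
      using closure_subset by (metis bounded_subset compact_imp_bounded image_mono)
  qed
  have bh: "bounded (h ` T) \<longleftrightarrow> bounded T" for T
  proof
    assume "bounded (h ` T)"
    from bdd [OF hk(2) this] show "bounded T"
      by (simp add: image_image hk)
  qed (rule bdd [OF hk(1)])
  have "h ` (- S) = - h ` S"
    using hk(3,4) by (intro bij_image_Compl_eq) (metis bijI')
  then have "homeomorphism (- S) (- h ` S) h k"
    by (intro homeomorphism_of_subsets [OF h]) auto
  then have "connected_component_set (- h ` S) (h x) = h ` connected_component_set (- S) x" if "x \<notin> S" for x
    using connected_component_set_homeomorphism that by fastforce
  moreover have "h x \<in> h ` S \<longleftrightarrow> x \<in> S" for x
    using hk(3) by (metis image_eqI imageE)
  ultimately have in_iff: "h x \<in> inside (h ` S) \<longleftrightarrow> x \<in> inside S" for x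
    by (auto simp: inside_def bh)
  show ?thesis
  proof (intro equalityI subsetI)
    fix z assume "z \<in> inside (h ` S)"
    then have "k z \<in> inside S"
      using in_iff [of "k z"] by (simp add: hk)
    then show "z \<in> h ` inside S"
      using hk(4) [of z] by (metis image_eqI)
  qed (use in_iff in auto)
qed

lemma Jordan_inside_outside_facts:
  fixes c :: "real \<Rightarrow> complex"
  assumes "simple_path c" "pathfinish c = pathstart c"
  shows "open (inside (path_image c))" "connected (inside (path_image c))" "bounded (inside (path_image c))"
    "inside (path_image c) \<noteq> {}"
    "open (outside (path_image c))" "connected (outside (path_image c))" "\<not> bounded (outside (path_image c))"
    "inside (path_image c) \<inter> outside (path_image c) = {}"
    "inside (path_image c) \<union> outside (path_image c) = - path_image c"
    "closure (inside (path_image c)) = inside (path_image c) \<union> path_image c"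
    "closure (outside (path_image c)) = outside (path_image c) \<union> path_image c"
  using Jordan_inside_outside [OF assms] by (simp_all add: closure_Un_frontier)

lemma connected_inside_or_outside:
  fixes c :: "real \<Rightarrow> complex"
  assumes c: "simple_path c" "pathfinish c = pathstart c" and K: "connected K" "K \<inter> path_image c = {}"
  shows "K \<subseteq> inside (path_image c) \<or> K \<subseteq> outside (path_image c)"
proof -
  note J = Jordan_inside_outside_facts [OF c]
  have "K \<subseteq> inside (path_image c) \<union> outside (path_image c)"
    unfolding J(9) using K(2) by blast
  moreover have "inside (path_image c) \<inter> outside (path_image c) \<inter> K = {}"
    using J(8) by blast
  ultimately show ?thesis
    using connectedD [OF K(1) J(1,5)] by blast
qed

lemma connected_inside_outside_Un_curve:
  fixes c :: "real \<Rightarrow> complex"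
  assumes c: "simple_path c" "pathfinish c = pathstart c"
  shows "connected (inside (path_image c) \<union> path_image c)"
    "connected (outside (path_image c) \<union> path_image c)"
  using connected_imp_connected_closure [OF Jordan_inside_outside_facts(2) [OF c]]
    connected_imp_connected_closure [OF Jordan_inside_outside_facts(6) [OF c]]
  by (simp_all add: Jordan_inside_outside_facts(10,11) [OF c])

text \<open>The outside of the first curve together with that curve is connected and misses the
  second, so it lies on one side of the second; being unbounded, it is not on the inside.\<close>

lemma outside_subset_if_curve_inside:
  fixes c c' :: "real \<Rightarrow> complex"
  assumes c: "simple_path c" "pathfinish c = pathstart c"
    and c': "simple_path c'" "pathfinish c' = pathstart c'"
    and "path_image c' \<subseteq> inside (path_image c)"
  shows "outside (path_image c) \<subseteq> outside (path_image c')"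
proof -
  note J = Jordan_inside_outside_facts [OF c] and J' = Jordan_inside_outside_facts [OF c']
  have "(outside (path_image c) \<union> path_image c) \<inter> path_image c' = {}"
    using assms(5) J(8,9) by blast
  with connected_inside_or_outside [OF c' connected_inside_outside_Un_curve(2) [OF c]]
  have "outside (path_image c) \<subseteq> inside (path_image c') \<or> outside (path_image c) \<subseteq> outside (path_image c')"
    by blast
  moreover have "\<not> outside (path_image c) \<subseteq> inside (path_image c')"
    using J(7) J'(3) bounded_subset by blast
  ultimately show ?thesis by blast
qed

text \<open>The set \<open>W\<close> is the outside of the outer curve. The common inner point
  \<open>p\<close> forces distinct curves to be nested.\<close>

lemma disjoint_Jordan_curves_outside:
  fixes c c' :: "real \<Rightarrow> complex"
  assumes c: "simple_path c" "pathfinish c = pathstart c"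
    and c': "simple_path c'" "pathfinish c' = pathstart c'"
    and disj: "path_image c = path_image c' \<or> disjnt (path_image c) (path_image c')"
    and p: "p \<in> inside (path_image c)" "p \<in> inside (path_image c')"
  shows "\<exists>W \<in> {outside (path_image c), outside (path_image c')}.
           W \<inter> inside (path_image c) = {} \<and> W \<inter> inside (path_image c') = {}"
proof (cases "path_image c = path_image c'")
  case True
  then show ?thesis
    using Jordan_inside_outside_facts(8) [OF c] by (simp add: Int_commute)
next
  case False
  note J = Jordan_inside_outside_facts [OF c] and J' = Jordan_inside_outside_facts [OF c']
  have d: "path_image c \<inter> path_image c' = {}"
    using disj False by (simp add: disjnt_def)
  have "connected (path_image c)" "connected (path_image c')"
    using c c' by (simp_all add: connected_simple_path_image)
  then consider "path_image c' \<subseteq> inside (path_image c)" | "path_image c \<subseteq> inside (path_image c')"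
    | "path_image c' \<subseteq> outside (path_image c)" "path_image c \<subseteq> outside (path_image c')"
    using connected_inside_or_outside [OF c, of "path_image c'"]
      connected_inside_or_outside [OF c', of "path_image c"] d by blast
  then show ?thesis
  proof cases
    case 1
    then show ?thesis
      using outside_subset_if_curve_inside [OF c c'] J(8) J'(8)
      by (intro bexI [of _ "outside (path_image c)"] conjI) blast+
  next
    case 2
    then show ?thesis
      using outside_subset_if_curve_inside [OF c' c] J(8) J'(8)
      by (intro bexI [of _ "outside (path_image c')"] conjI) blast+
  next
    case 3
    \<comment> \<open>If each curve lay outside the other, the closed inside of \<open>c\<close>
      would miss \<open>c'\<close> and contain \<open>p\<close>, so it would lie inside
      \<open>c'\<close>, and with it the curve \<open>c\<close>.\<close>
    have "(inside (path_image c) \<union> path_image c) \<inter> path_image c' = {}"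
      using 3 J(8) d by blast
    with connected_inside_or_outside [OF c' connected_inside_outside_Un_curve(1) [OF c]]
    have "inside (path_image c) \<union> path_image c \<subseteq> inside (path_image c')"
      using p J'(8) by blast
    then have "path_image c = {}"
      using 3 J'(8) by blast
    then show ?thesis
      using c(1) by simp
  qed
qed

section \<open>The sphere and its planar charts\<close>

lemma S2_eq: "S2 = {x. (\<Sum>i\<le>2. (x i)\<^sup>2) = 1 \<and> (\<forall>i>2. x i = 0)}"
  by (auto simp: S2_def nsphere)

text \<open>Moves the sphere into a Euclidean space, where compactness and stereographic projection
  are at hand.\<close>

lemma S2_homeomorphic_sphere: "S2 homeomorphic sphere (0 :: complex \<times> real) 1"
proof -
  define \<phi> :: "(nat \<Rightarrow> real) \<Rightarrow> complex \<times> real" where "\<phi> = (\<lambda>x. (Complex (x 0) (x 1), x 2))"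
  define \<psi> :: "complex \<times> real \<Rightarrow> nat \<Rightarrow> real"
    where "\<psi> = (\<lambda>(z, r) i. if i = 0 then Re z else if i = 1 then Im z else if i = 2 then r else 0)"
  have sum: "(\<Sum>i\<le>2. (x i)\<^sup>2) = (x 0)\<^sup>2 + (x 1)\<^sup>2 + (x 2)\<^sup>2" for x :: "nat \<Rightarrow> real"
    by (simp add: numeral_2_eq_2)
  have norm: "norm (\<phi> x) = 1 \<longleftrightarrow> (x 0)\<^sup>2 + (x 1)\<^sup>2 + (x 2)\<^sup>2 = 1" for x
    by (simp add: \<phi>_def norm_prod_def cmod_def)
  have inv: "\<phi> (\<psi> u) = u" for u
    by (simp add: \<phi>_def \<psi>_def case_prod_unfold)
  have inv': "\<psi> (\<phi> x) = x" if "x \<in> S2" for x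
  proof
    fix i :: nat
    have "x i = 0" if "2 < i"
      using \<open>x \<in> S2\<close> that by (simp add: S2_eq)
    then show "\<psi> (\<phi> x) i = x i"
      by (cases "i \<le> 2") (auto simp: \<phi>_def \<psi>_def le_Suc_eq numeral_2_eq_2)
  qed
  have "homeomorphism S2 (sphere 0 1) \<phi> \<psi>"
  proof (rule homeomorphismI)
    have c: "continuous_on S2 (\<lambda>x. x i)" for i :: nat
      by (rule continuous_on_subset [OF continuous_on_product_coordinates]) simp
    show "continuous_on S2 \<phi>"
      unfolding \<phi>_def by (intro continuous_intros continuous_on_Complex c)
    show "continuous_on (sphere 0 1) \<psi>"
    proof (rule continuous_on_coordinatewise_then_product)
      fix i
      show "continuous_on (sphere 0 1) (\<lambda>u. \<psi> u i)"
        unfolding \<psi>_def case_prod_unfold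
        by (cases "i = 0"; cases "i = 1"; cases "i = 2") (auto intro!: continuous_intros)
    qed
    show "\<phi> ` S2 \<subseteq> sphere 0 1"
      using norm sum by (auto simp: S2_eq)
    have "\<psi> u \<in> S2" if "norm u = 1" for u
    proof -
      have "(\<Sum>i\<le>2. (\<psi> u i)\<^sup>2) = 1"
        using norm [of "\<psi> u"] that by (simp add: sum inv)
      then show ?thesis
        by (simp add: S2_eq) (simp add: \<psi>_def case_prod_unfold)
    qed
    then show "\<psi> ` sphere 0 1 \<subseteq> S2"
      by auto
  qed (use inv inv' in auto)
  then show ?thesis
    by (auto simp: homeomorphic_def)
qed

lemma compact_S2: "compact S2"
  using homeomorphic_compactness [OF S2_homeomorphic_sphere] by simp

text \<open>Stereographic projection from \<open>w\<close> onto the hyperplane orthogonal to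
  \<open>(0, 1)\<close>, which the first coordinate identifies with the complex plane.\<close>

lemma S2_chart_exists:
  assumes "w \<in> S2"
  obtains e e' where "homeomorphism (S2 - {w}) (UNIV :: complex set) e e'"
proof -
  obtain \<phi> \<psi> where \<phi>: "homeomorphism S2 (sphere (0 :: complex \<times> real) 1) \<phi> \<psi>"
    using S2_homeomorphic_sphere by (auto simp: homeomorphic_def)
  have "\<phi> ` (S2 - {w}) = sphere 0 1 - {\<phi> w}"
  proof -
    have "inj_on \<phi> S2" "\<phi> ` S2 = sphere 0 1"
      using \<phi> by (auto simp: homeomorphism_def intro: inj_on_inverseI)
    then show ?thesis
      using assms inj_on_image_set_diff [of \<phi> S2 S2 "{w}"] by simp
  qed
  then have "S2 - {w} homeomorphic sphere 0 1 - {\<phi> w}"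
    using homeomorphism_of_subsets [OF \<phi>, of "S2 - {w}" "sphere 0 1" "sphere 0 1 - {\<phi> w}"]
    by (auto simp: homeomorphic_def)
  also have "sphere 0 1 - {\<phi> w} homeomorphic {u :: complex \<times> real. (0, 1) \<bullet> u = 0}"
    using \<phi> assms by (intro homeomorphic_punctured_sphere_hyperplane) (auto simp: homeomorphism_def zero_prod_def)
  also have "{u :: complex \<times> real. (0, 1) \<bullet> u = 0} homeomorphic (UNIV :: complex set)"
    unfolding homeomorphic_def
    by (intro exI [of _ fst] exI [of _ "\<lambda>z. (z, 0)"] homeomorphismI)
      (auto intro!: continuous_intros simp: inner_prod_def)
  finally show ?thesis
    using that by (auto simp: homeomorphic_def)
qed

section \<open>Isotopies of the sphere relative to marked points\<close>

lemma isotopic_rel_iff_homotopic_with: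
  assumes "Y \<subseteq> S2"
  shows "isotopic_rel Y f g \<longleftrightarrow>
    homotopic_with_canon (\<lambda>h. (\<exists>k. homeomorphism S2 S2 h k) \<and> h ` Y = Y) S2 S2 f g"
proof -
  \<comment> \<open>The inclusion of \<open>Y\<close> in \<open>S2\<close> makes the condition
    depend only on values on \<open>S2\<close>.\<close>
  have P: "((\<exists>l. homeomorphism S2 S2 h l) \<and> h ` Y = Y) = ((\<exists>l. homeomorphism S2 S2 k l) \<and> k ` Y = Y)"
    if "\<And>x. x \<in> topspace (top_of_set S2) \<Longrightarrow> h x = k x" for h k :: "(nat \<Rightarrow> real) \<Rightarrow> nat \<Rightarrow> real"
  proof -
    have "h ` Y = k ` Y"
      using that assms by (intro image_cong) auto
    moreover have "homeomorphism S2 S2 h l = homeomorphism S2 S2 k l" for l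
      using homeomorphism_cong [of S2 S2 h l S2 S2 k l] homeomorphism_cong [of S2 S2 k l S2 S2 h l] that by auto
    ultimately show ?thesis by simp
  qed
  show ?thesis
    unfolding isotopic_rel_def
    by (subst homotopic_with [where P = "\<lambda>h. (\<exists>k. homeomorphism S2 S2 h k) \<and> h ` Y = Y", OF P])
      (auto simp: image_subset_iff_funcset)
qed

lemma isotopic_rel_sym: "Y \<subseteq> S2 \<Longrightarrow> isotopic_rel Y f g \<Longrightarrow> isotopic_rel Y g f"
  by (simp add: isotopic_rel_iff_homotopic_with homotopic_with_sym)

lemma isotopic_rel_trans:
  "Y \<subseteq> S2 \<Longrightarrow> isotopic_rel Y f g \<Longrightarrow> isotopic_rel Y g h \<Longrightarrow> isotopic_rel Y f h"
  by (simp add: isotopic_rel_iff_homotopic_with) (rule homotopic_with_trans)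

text \<open>By compactness of \<open>S2\<close>, continuous bijections of it are homeomorphisms, so
  no inverse has to be supplied.\<close>

lemma isotopic_relI:
  fixes H :: "real \<times> (nat \<Rightarrow> real) \<Rightarrow> nat \<Rightarrow> real"
  assumes "continuous_on ({0..1} \<times> S2) H" "\<And>t. t \<in> {0..1} \<Longrightarrow> bij_betw (\<lambda>x. H (t, x)) S2 S2"
    and "\<And>x. x \<in> S2 \<Longrightarrow> H (0, x) = f x" "\<And>x. x \<in> S2 \<Longrightarrow> H (1, x) = g x"
    and "\<And>t y. t \<in> {0..1} \<Longrightarrow> y \<in> Y \<Longrightarrow> H (t, y) = y"
  shows "isotopic_rel Y f g"
proof -
  have "\<exists>k. homeomorphism S2 S2 (\<lambda>x. H (t, x)) k" if "t \<in> {0..1}" for t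
    using assms(2) [OF that] that
    by (intro homeomorphism_compact compact_S2 continuous_on_compose2 [OF assms(1)] continuous_intros)
      (auto simp: bij_betw_def)
  moreover have "H ` ({0..1} \<times> S2) \<subseteq> S2"
    using assms(2) by (fastforce simp: bij_betw_def)
  moreover have "(\<lambda>x. H (t, x)) ` Y = Y" if "t \<in> {0..1}" for t
    using assms(5) [OF that] by force
  ultimately show ?thesis
    unfolding isotopic_rel_def using assms by (intro exI [of _ H]) auto
qed

text \<open>\<open>isotopic_rel\<close> preserves \<open>Y\<close> only as a set, but the track of a
  marked point is a connected subset of the finite set \<open>Y\<close>, hence a single point, and
  it starts at \<open>f y = y\<close>.\<close>

lemma isotopic_relE:
  assumes "isotopic_rel Y f g" "finite Y" "Y \<subseteq> S2" "\<And>y. y \<in> Y \<Longrightarrow> f y = y"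
  obtains H :: "real \<times> (nat \<Rightarrow> real) \<Rightarrow> nat \<Rightarrow> real" where "continuous_on ({0..1} \<times> S2) H" "\<And>t. t \<in> {0..1} \<Longrightarrow> bij_betw (\<lambda>x. H (t, x)) S2 S2"
    "\<And>x. x \<in> S2 \<Longrightarrow> H (0, x) = f x" "\<And>x. x \<in> S2 \<Longrightarrow> H (1, x) = g x"
    "\<And>t y. t \<in> {0..1} \<Longrightarrow> y \<in> Y \<Longrightarrow> H (t, y) = y"
proof -
  obtain H :: "real \<times> (nat \<Rightarrow> real) \<Rightarrow> nat \<Rightarrow> real" where H: "continuous_on ({0..1} \<times> S2) H" 
      "\<forall>x\<in>S2. H (0, x) = f x" "\<forall>x\<in>S2. H (1, x) = g x"
      "\<forall>t\<in>{0..1}. (\<exists>k. homeomorphism S2 S2 (\<lambda>x. H (t, x)) k) \<and> (\<lambda>x. H (t, x)) ` Y = Y"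
    using assms(1) unfolding isotopic_rel_def by (elim exE conjE) (rule that, assumption+)
  show ?thesis
  proof (rule that [OF H(1)])
    show "bij_betw (\<lambda>x. H (t, x)) S2 S2" if "t \<in> {0..1}" for t
    proof -
      obtain k where "homeomorphism S2 S2 (\<lambda>x. H (t, x)) k"
        using H(4) \<open>t \<in> {0..1}\<close> by blast
      then show ?thesis
        unfolding homeomorphism_def bij_betw_def by (metis inj_on_inverseI)
    qed
    show "H (t, y) = y" if "t \<in> {0..1}" "y \<in> Y" for t y
    proof -
      have "connected ((\<lambda>t. H (t, y)) ` {0..1})"
        using assms that by (intro connected_continuous_image continuous_on_compose2 [OF H(1)] continuous_intros) auto
      moreover have "finite ((\<lambda>t. H (t, y)) ` {0..1})"
        using H(4) that assms(2) by (force intro: finite_subset [of _ Y])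
      ultimately obtain a where "(\<lambda>t. H (t, y)) ` {0..1} = {a}"
        using connected_finite_iff_sing by fastforce
      then have "H (t, y) = H (0, y)"
        using that by (metis (mono_tags, lifting) atLeastAtMost_iff image_eqI order_refl singletonD zero_le_one)
      then show ?thesis
        using H(2) assms that by auto
    qed
  qed (use H in auto)
qed

section \<open>Passing between the sphere and the plane\<close>

lemma plane_isotopy_extends:
  fixes \<Phi> :: "real \<times> complex \<Rightarrow> complex"
  assumes e: "homeomorphism (S2 - {w}) (UNIV :: complex set) e e'" and w: "w \<in> S2"
    and \<Phi>: "continuous_on ({0..1} \<times> UNIV) \<Phi>" "\<And>t. t \<in> {0..1} \<Longrightarrow> bij (\<lambda>z. \<Phi> (t, z))"
      "\<And>t z. t \<in> {0..1} \<Longrightarrow> R < norm z \<Longrightarrow> \<Phi> (t, z) = z"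
  defines "\<Psi> \<equiv> (\<lambda>(t, x). if x = w then w else e' (\<Phi> (t, e x)))"
  shows "continuous_on ({0..1} \<times> S2) \<Psi>" "\<And>t. t \<in> {0..1} \<Longrightarrow> bij_betw (\<lambda>x. \<Psi> (t, x)) S2 S2"
proof -
  have ee: "continuous_on (S2 - {w}) e" "continuous_on UNIV e'" "\<And>x. x \<in> S2 - {w} \<Longrightarrow> e' (e x) = x"
     "\<And>z. e (e' z) = z" "\<And>z. e' z \<in> S2 - {w}"
    using e by (auto simp: homeomorphism_def)
  let ?K = "e' ` cball 0 R"
  have "compact ?K"
    using ee by (intro compact_continuous_image) (auto intro: continuous_on_subset)
  then have K: "closed ?K" 
    by (rule compact_imp_closed)
  have eq: "\<Psi> (t, x) = x" if "t \<in> {0..1}" "x \<in> S2 - ?K" for t x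
  proof (cases "x = w")
    case False
    then have "R < norm (e x)"
      using that ee(3) [of x] by (metis DiffD1 DiffD2 DiffI dist_0_norm empty_iff image_eqI insert_iff mem_cball not_le)
    then show ?thesis
      using that False \<Phi>(3) ee(3) by (simp add: \<Psi>_def)
  qed (simp add: \<Psi>_def)
  \<comment> \<open>Away from \<open>w\<close> the chart formula is continuous; away from the
    compact set \<open>?K\<close>, hence near \<open>w\<close>, every stage is the identity. The two
    relatively open pieces cover everything.\<close>
  have cover: "({0..1::real} \<times> S2) \<inter> (UNIV \<times> - {w}) \<union> ({0..1::real} \<times> S2) \<inter> (UNIV \<times> - ?K) = {0..1::real} \<times> S2"
    using ee(5) by auto
  have "continuous_on (({0..1::real} \<times> S2) \<inter> (UNIV \<times> - {w}) \<union> ({0..1::real} \<times> S2) \<inter> (UNIV \<times> - ?K)) \<Psi>"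
  proof (rule continuous_on_Un_local_open)
    have "open (UNIV \<times> - {w} :: (real \<times> (nat \<Rightarrow> real)) set)" "open (UNIV \<times> - ?K :: (real \<times> (nat \<Rightarrow> real)) set)"
      using K by (auto intro!: open_Times)
    then show "openin (top_of_set (({0..1::real} \<times> S2) \<inter> (UNIV \<times> - {w}) \<union> ({0..1::real} \<times> S2) \<inter> (UNIV \<times> - ?K))) (({0..1::real} \<times> S2) \<inter> (UNIV \<times> - {w}))"
      "openin (top_of_set (({0..1::real} \<times> S2) \<inter> (UNIV \<times> - {w}) \<union> ({0..1::real} \<times> S2) \<inter> (UNIV \<times> - ?K))) (({0..1::real} \<times> S2) \<inter> (UNIV \<times> - ?K))"
      using cover by (metis openin_open_Int)+
    have "continuous_on (({0..1::real} \<times> S2) \<inter> (UNIV \<times> - {w})) (\<lambda>x. e' (\<Phi> (fst x, e (snd x))))"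
      by (intro continuous_on_compose2 [OF ee(2)] continuous_on_compose2 [OF \<Phi>(1)]
          continuous_on_compose2 [OF ee(1)] continuous_intros) auto
    then show "continuous_on (({0..1::real} \<times> S2) \<inter> (UNIV \<times> - {w})) \<Psi>"
      by (rule continuous_on_eq) (auto simp: \<Psi>_def)
    have "continuous_on (({0..1::real} \<times> S2) \<inter> (UNIV \<times> - ?K)) snd"
      by (intro continuous_intros)
    then show "continuous_on (({0..1::real} \<times> S2) \<inter> (UNIV \<times> - ?K)) \<Psi>"
      by (rule continuous_on_eq) (use eq in auto)
  qed
  then show "continuous_on ({0..1} \<times> S2) \<Psi>"
    by (simp only: cover)
  show "bij_betw (\<lambda>x. \<Psi> (t, x)) S2 S2" if t: "t \<in> {0..1}" for t
  proof -
    let ?i = "inv_into UNIV (\<lambda>z. \<Phi> (t, z))"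
    have i: "?i (\<Phi> (t, z)) = z" "\<Phi> (t, ?i z) = z" for z
      using inv_f_f [OF bij_is_inj [OF \<Phi>(2) [OF t]], of z] surj_f_inv_f [OF bij_is_surj [OF \<Phi>(2) [OF t]], of z]
      by auto
    show ?thesis
      by (rule bij_betw_byWitness [where f' = "\<lambda>x. if x = w then w else e' (?i (e x))"])
        (use ee i w in \<open>auto simp: \<Psi>_def\<close>)
  qed
qed

text \<open>The inside of the planar curve pulls back to one side \<open>U\<close> of
  \<open>C\<close>, and the component of \<open>w\<close> lies off \<open>U\<close>. The second
  count includes \<open>w\<close> itself, so in the plane it guarantees one marked point outside the
  curve.\<close>

lemma essential_curve_in_chart:
  fixes e :: "(nat \<Rightarrow> real) \<Rightarrow> complex"
  assumes e: "homeomorphism (S2 - {w}) UNIV e e'" and Y: "finite Y" "w \<in> Y" "Y \<subseteq> S2"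
    and C: "essential_curve Y C"
  obtains c where "simple_path c" "pathfinish c = pathstart c" "path_image c = e ` C"
    "2 \<le> card (Y \<inter> e' ` inside (e ` C))" "2 \<le> card (Y - e' ` inside (e ` C))"
proof -
  have CS: "C \<subseteq> S2 - {w}" "C \<inter> Y = {}"
    using C Y by (auto simp: essential_curve_def)
  obtain c0 where c0: "simple_path c0" "pathfinish c0 = pathstart c0" "path_image c0 = C"
    using C by (auto simp: essential_curve_def simple_closed_curve_def)
  have ee: "continuous_on (S2 - {w}) e" "continuous_on UNIV e'" "\<And>x. x \<in> S2 - {w} \<Longrightarrow> e' (e x) = x"
     "\<And>z. e (e' z) = z" "\<And>z. e' z \<in> S2 - {w}"
    using e by (auto simp: homeomorphism_def)
  define c where "c = e \<circ> c0"
  have pim: "path_image c = e ` C"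
    using c0 by (simp add: c_def path_image_compose)
  have "path c"
    using c0 CS ee(1) by (auto simp: c_def simple_path_def intro!: path_continuous_image continuous_on_subset [OF ee(1)])
  moreover have "loop_free c"
  proof -
    have "c0 s \<in> S2 - {w}" if "s \<in> {0..1}" for s
      using c0(3) CS(1) that unfolding path_image_def by blast
    then have "c0 s = c0 t" if "s \<in> {0..1}" "t \<in> {0..1}" "c s = c t" for s t
      using that ee(3) by (metis c_def comp_apply)
    then show ?thesis
      using c0(1) unfolding simple_path_def loop_free_def by blast
  qed
  ultimately have sc: "simple_path c" "pathfinish c = pathstart c"
    using c0(2) by (auto simp: simple_path_def c_def pathfinish_def pathstart_def)
  note J = Jordan_inside_outside_facts [OF sc, unfolded pim]
  define U where "U = e' ` inside (e ` C)"
  have "openin (top_of_set (S2 - {w})) U"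
    unfolding U_def using J(1) by (intro homeomorphism_imp_open_map [OF homeomorphism_symD [OF e]]) auto
  moreover have "openin (top_of_set S2) (S2 - {w})"
    by (simp add: openin_delete)
  ultimately obtain O1 where O1: "open O1" "U = S2 \<inter> O1"
    using openin_trans by (meson openin_open)
  have UC: "U \<inter> C = {}"
  proof -
    have "e x \<in> inside (e ` C)" if "x \<in> U" for x
      using that ee(4) by (auto simp: U_def)
    then show ?thesis
      using inside_no_overlap [of "e ` C"] by blast
  qed
  have D: "U \<union> C = e' ` (inside (e ` C) \<union> e ` C)"
    unfolding U_def image_Un image_image using CS ee(3) by (auto simp: subset_iff)
  have "closed (inside (e ` C) \<union> e ` C)"
    by (metis J(10) closed_closure)
  moreover have "bounded (inside (e ` C) \<union> e ` C)"
    using J(3) sc(1) pim by (metis bounded_Un bounded_simple_path_image)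
  ultimately have "compact (inside (e ` C) \<union> e ` C)"
    by (simp add: compact_eq_bounded_closed)
  then have "compact (U \<union> C)"
    unfolding D using ee(2) by (intro compact_continuous_image) (auto intro: continuous_on_subset)
  then have cl: "open (- (U \<union> C))"
    using compact_imp_closed by blast
  have wU: "w \<notin> U \<union> C"
    using CS ee(5) by (auto simp: U_def)
  \<comment> \<open>\<open>U\<close> is relatively open, and so is the complement of the compact set
    \<open>U \<union> C\<close>, so a connected set missing \<open>C\<close> cannot meet
    both.\<close>
  have sep: "K \<inter> U = {} \<or> K \<subseteq> U" if "connected K" "K \<subseteq> S2 - C" for K
    using connectedD [OF that(1) O1(1) cl] O1(2) that(2) UC by blast
  have comp: "2 \<le> card (Y \<inter> T)" if x: "x \<in> S2 - C" and sub: "connected_component_set (S2 - C) x \<subseteq> T" for x T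
  proof -
    have "connected_component_set (S2 - C) x \<in> components (S2 - C)"
      using x by (auto simp: components_def)
    then have "2 \<le> card (connected_component_set (S2 - C) x \<inter> Y)"
      using C by (auto simp: essential_curve_def)
    also have "\<dots> \<le> card (Y \<inter> T)"
      using Y sub by (intro card_mono) auto
    finally show ?thesis .
  qed
  obtain z where "z \<in> inside (e ` C)"
    using J(4) by blast
  then have u: "e' z \<in> U" "e' z \<in> S2 - C"
    using UC ee(5) [of z] by (auto simp: U_def)
  have inU: "2 \<le> card (Y \<inter> U)"
  proof (rule comp [OF u(2)])
    have "e' z \<in> connected_component_set (S2 - C) (e' z)"
      using u by simp
    then show "connected_component_set (S2 - C) (e' z) \<subseteq> U"
      using sep [OF connected_connected_component connected_component_subset, of "e' z"] u(1) by blast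
  qed
  have wS: "w \<in> S2 - C"
    using Y CS by blast
  have outU: "2 \<le> card (Y \<inter> - U)"
  proof (rule comp [OF wS])
    have "w \<in> connected_component_set (S2 - C) w"
      using wS by simp
    then show "connected_component_set (S2 - C) w \<subseteq> - U"
      using sep [OF connected_connected_component connected_component_subset, of w] wU by blast
  qed
  show ?thesis
    using that [OF sc pim] inU outU by (simp add: U_def Diff_eq)
qed

text \<open>Since \<open>w\<close> stays fixed, each stage preserves the punctured sphere and can be
  conjugated to the plane.\<close>

lemma isotopy_in_chart:
  fixes e :: "(nat \<Rightarrow> real) \<Rightarrow> complex" and H :: "real \<times> (nat \<Rightarrow> real) \<Rightarrow> nat \<Rightarrow> real"
  assumes e: "homeomorphism (S2 - {w}) UNIV e e'" and w: "w \<in> S2"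
    and H: "continuous_on ({0..1} \<times> S2) H" "\<And>t. t \<in> {0..1} \<Longrightarrow> bij_betw (\<lambda>x. H (t, x)) S2 S2"
      "\<And>t. t \<in> {0..1} \<Longrightarrow> H (t, w) = w"
  defines "F \<equiv> (\<lambda>x. e (H (fst x, e' (snd x))))"
  shows "continuous_on ({0..1} \<times> UNIV) F" "\<And>t. t \<in> {0..1} \<Longrightarrow> inj (\<lambda>z. F (t, z))"
    "\<And>t z. t \<in> {0..1} \<Longrightarrow> H (t, e' z) \<in> S2 - {w}"
proof -
  have ee: "continuous_on (S2 - {w}) e" "continuous_on UNIV e'" "\<And>x. x \<in> S2 - {w} \<Longrightarrow> e' (e x) = x"
     "\<And>z. e (e' z) = z" "\<And>z. e' z \<in> S2 - {w}"
    using e by (auto simp: homeomorphism_def)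
  show HS: "H (t, e' z) \<in> S2 - {w}" if "t \<in> {0..1}" for t z
    using H(2,3) [OF that] ee(5) [of z] w unfolding bij_betw_def inj_on_def by (metis Diff_iff image_eqI singletonD singletonI)
  show "continuous_on ({0..1} \<times> UNIV) F"
  proof -
    have "(\<lambda>x. H (fst x, e' (snd x))) ` ({0..1} \<times> UNIV) \<subseteq> S2 - {w}"
      using HS unfolding image_subset_iff by (simp add: mem_Times_iff)
    moreover have "continuous_on ({0..1} \<times> UNIV) (\<lambda>x. H (fst x, e' (snd x)))"
      using ee(5) by (intro continuous_on_compose2 [OF H(1)] continuous_on_compose2 [OF ee(2)] continuous_intros) auto
    ultimately show ?thesis
      unfolding F_def using continuous_on_compose2 [OF ee(1)] by blast
  qed
  show "inj (\<lambda>z. F (t, z))" if "t \<in> {0..1}" for t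
  proof (rule injI)
    fix x y assume "F (t, x) = F (t, y)"
    then have "H (t, e' x) = H (t, e' y)"
      using ee(3) HS [OF that] by (metis F_def fst_conv snd_conv)
    then have "e' x = e' y"
      using H(2) [OF that] ee(5) unfolding bij_betw_def inj_on_def by blast
    then show "x = y"
      using ee(4) by metis
  qed
qed

lemma homeomorphism_in_chart:
  fixes e :: "(nat \<Rightarrow> real) \<Rightarrow> complex"
  assumes e: "homeomorphism (S2 - {w}) UNIV e e'" and w: "w \<in> S2"
    and g: "homeomorphism S2 S2 g k" "g w = w"
  shows "homeomorphism UNIV UNIV (e \<circ> (g \<circ> e')) (e \<circ> k \<circ> e')"
proof -
  have "g ` (S2 - {w}) = S2 - {w}"
  proof -
    have "inj_on g S2" "g ` S2 = S2"
      using g(1) by (auto simp: homeomorphism_def intro: inj_on_inverseI)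
    then show ?thesis
      using w g(2) inj_on_image_set_diff [of g S2 S2 "{w}"] by simp
  qed
  then have "homeomorphism (S2 - {w}) (S2 - {w}) g k"
    by (intro homeomorphism_of_subsets [OF g(1)]) auto
  then show ?thesis
    by (intro homeomorphism_compose [OF _ e] homeomorphism_compose [OF homeomorphism_symD [OF e]])
qed

section \<open>Reducible Brunnian mapping classes\<close>

lemma reduced_Brunnian_isotopic_to_id:
  assumes Y: "finite Y" "Y \<subseteq> S2" "5 \<le> card Y" and g: "homeomorphism S2 S2 g k" "\<And>v. v \<in> Y \<Longrightarrow> g v = v"
    and Br: "\<And>v. v \<in> Y \<Longrightarrow> isotopic_rel (Y - {v}) g id"
    and C: "essential_curve Y C" "essential_curve Y (g ` C)" "C = g ` C \<or> disjnt C (g ` C)"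
  shows "isotopic_rel Y g id"
proof -
  obtain w where w: "w \<in> Y"
    using Y by fastforce
  with Y have wS: "w \<in> S2" by blast
  obtain e :: "(nat \<Rightarrow> real) \<Rightarrow> complex" and e' where e: "homeomorphism (S2 - {w}) UNIV e e'"
    by (rule S2_chart_exists [OF wS])
  have ee: "\<And>x. x \<in> S2 - {w} \<Longrightarrow> e' (e x) = x" "\<And>z. e (e' z) = z" "\<And>z. e' z \<in> S2 - {w}"
    using e by (auto simp: homeomorphism_def)
  have einj: "e x = e x' \<longleftrightarrow> x = x'" if "x \<in> S2 - {w}" "x' \<in> S2 - {w}" for x x'
    using ee(1) that by metis
  obtain c where c: "simple_path c" "pathfinish c = pathstart c" "path_image c = e ` C"
    "2 \<le> card (Y \<inter> e' ` inside (e ` C))" "2 \<le> card (Y - e' ` inside (e ` C))"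
    by (rule essential_curve_in_chart [OF e Y(1) w Y(2) C(1)])
  obtain c' where c': "simple_path c'" "pathfinish c' = pathstart c'" "path_image c' = e ` g ` C"
    by (rule essential_curve_in_chart [OF e Y(1) w Y(2) C(2)])
  have CY: "C \<subseteq> S2 - Y" "g ` C \<subseteq> S2 - Y"
    using C(1,2) by (auto simp: essential_curve_def)
  define U where "U = inside (e ` C)"
  note J = Jordan_inside_outside_facts [OF c(1,2), unfolded c(3), folded U_def]
    and J' = Jordan_inside_outside_facts [OF c'(1,2), unfolded c'(3)]
  have UY: "v \<in> e' ` U \<longleftrightarrow> e v \<in> U" if "v \<in> Y - {w}" for v
    using ee that Y(2) by (metis Diff_iff image_iff subsetD)
  have wU: "w \<notin> e' ` U"
    using ee(3) by blast
  have "\<not> card (Y \<inter> e' ` U) \<le> Suc 0"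
    using c(4) by (simp add: U_def)
  then obtain p0 b0 where p0: "p0 \<in> Y \<inter> e' ` U" and b0: "b0 \<in> Y \<inter> e' ` U" "p0 \<noteq> b0"
    using card_le_Suc0_iff_eq [of "Y \<inter> e' ` U"] Y(1) by (metis finite_Int)
  have "2 \<le> card (Y - e' ` U)"
    using c(5) by (simp add: U_def)
  moreover have "card (Y - e' ` U) \<le> 1" if "Y - e' ` U \<subseteq> {w}"
    using card_mono [OF _ that] by simp
  ultimately have "\<not> Y - e' ` U \<subseteq> {w}"
    by linarith
  then obtain a0 where a0: "a0 \<in> Y - e' ` U" "a0 \<noteq> w"
    by blast
  \<comment> \<open>Here the bound 5 enters: the point at infinity \<open>w\<close>, the inner
    points \<open>p0\<close> and \<open>b0\<close> and the outer point \<open>a0\<close> are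
    distinct, and a further marked point \<open>d0\<close> remains, on either side of the
    curve.\<close>
  have "\<not> Y \<subseteq> {w, p0, b0, a0}"
  proof
    assume "Y \<subseteq> {w, p0, b0, a0}"
    then have "card Y \<le> card {w, p0, b0, a0}"
      by (intro card_mono) auto
    also have "\<dots> \<le> 4"
      by (simp add: card_insert_if)
    finally show False using Y(3) by simp
  qed
  then obtain d0 where d0: "d0 \<in> Y" "d0 \<notin> {w, p0, b0, a0}"
    by blast
  have p0Y: "p0 \<in> Y" and a0Y: "a0 \<in> Y"
    using p0 a0 by blast+
  have pw: "p0 \<noteq> w" "b0 \<noteq> w"
    using p0 b0 wU by auto
  have Yv: "isotopic_rel (Y - {v}) g id" "finite (Y - {v})" "Y - {v} \<subseteq> S2" "\<And>u. u \<in> Y - {v} \<Longrightarrow> g u = u" if "v \<in> Y" for v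
    using Y(1,2) g(2) Br that by auto
  \<comment> \<open>\<open>H1\<close> is free only at the inner point \<open>p0\<close> and
    \<open>H2\<close> only at the outer point \<open>a0\<close>, so both fix \<open>w\<close>,
    \<open>b0\<close> and \<open>d0\<close>.\<close>
  obtain H1 :: "real \<times> (nat \<Rightarrow> real) \<Rightarrow> nat \<Rightarrow> real" where H1: "continuous_on ({0..1} \<times> S2) H1"
      "\<And>t. t \<in> {0..1} \<Longrightarrow> bij_betw (\<lambda>x. H1 (t, x)) S2 S2"
      "\<And>x. x \<in> S2 \<Longrightarrow> H1 (0, x) = g x" "\<And>x. x \<in> S2 \<Longrightarrow> H1 (1, x) = id x"
      "\<And>t y. t \<in> {0..1} \<Longrightarrow> y \<in> Y - {p0} \<Longrightarrow> H1 (t, y) = y"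
    using isotopic_relE [OF Yv [OF p0Y]] by blast
  obtain H2 :: "real \<times> (nat \<Rightarrow> real) \<Rightarrow> nat \<Rightarrow> real" where H2: "continuous_on ({0..1} \<times> S2) H2"
      "\<And>t. t \<in> {0..1} \<Longrightarrow> bij_betw (\<lambda>x. H2 (t, x)) S2 S2"
      "\<And>x. x \<in> S2 \<Longrightarrow> H2 (0, x) = g x" "\<And>x. x \<in> S2 \<Longrightarrow> H2 (1, x) = id x"
      "\<And>t y. t \<in> {0..1} \<Longrightarrow> y \<in> Y - {a0} \<Longrightarrow> H2 (t, y) = y"
    using isotopic_relE [OF Yv [OF a0Y]] by blast
  define F where "F = (\<lambda>x. e (H1 (fst x, e' (snd x))))"
  define G where "G = (\<lambda>x. e (H2 (fst x, e' (snd x))))"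
  have H1w: "\<And>t. t \<in> {0..1} \<Longrightarrow> H1 (t, w) = w" and H2w: "\<And>t. t \<in> {0..1} \<Longrightarrow> H2 (t, w) = w"
    using H1(5) H2(5) w pw a0 by auto
  have Fc: "continuous_on ({0..1} \<times> UNIV) F" "\<And>t. t \<in> {0..1} \<Longrightarrow> inj (\<lambda>z. F (t, z))"
      "\<And>t z. t \<in> {0..1} \<Longrightarrow> H1 (t, e' z) \<in> S2 - {w}"
    unfolding F_def by (rule isotopy_in_chart [OF e wS H1(1)]; use H1(2) H1w in simp)+
  have Gc: "continuous_on ({0..1} \<times> UNIV) G" "\<And>t. t \<in> {0..1} \<Longrightarrow> inj (\<lambda>z. G (t, z))"
    unfolding G_def by (rule isotopy_in_chart [OF e wS H2(1)]; use H2(2) H2w in simp)+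
  have chart: "Y - {w} \<subseteq> S2 - {w}"
    using Y(2) by blast
  have fixF: "F (t, e v) = e v" if "t \<in> {0..1}" "v \<in> Y - {w, p0}" for t v
    using H1(5) [OF that(1), of v] that(2) ee(1) [of v] chart by (auto simp: F_def)
  have fixG: "G (t, e v) = e v" if "t \<in> {0..1}" "v \<in> Y - {w, a0}" for t v
    using H2(5) [OF that(1), of v] that(2) ee(1) [of v] chart by (auto simp: G_def)
  have F0: "F (0, z) = (e \<circ> (g \<circ> e')) z" and G0: "G (0, z) = (e \<circ> (g \<circ> e')) z" and F1: "F (1, z) = z" "G (1, z) = z" for z
    using H1(3,4) [of "e' z"] H2(3,4) [of "e' z"] ee(2,3) [of z] by (auto simp: F_def G_def)
  \<comment> \<open>The map at time 0 is \<open>g\<close> read in the chart, a homeomorphism of the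
    plane, so it takes the inside of the curve to the inside of the image curve.\<close>
  have U': "(\<lambda>z. F (0, z)) ` U = inside (e ` g ` C)"
  proof -
    have "e' (e x) = x" if "x \<in> C" for x
      using CY(1) w that by (intro ee(1)) blast
    then have "(e \<circ> (g \<circ> e')) ` e ` C = e ` g ` C"
      unfolding image_image comp_def by simp
    then show ?thesis
      using inside_homeomorphism_image [OF homeomorphism_in_chart [OF e wS g(1) g(2) [OF w]], of "e ` C"]
      by (simp add: U_def F0)
  qed
  \<comment> \<open>\<open>A\<close> collects the marked points of the plane outside the curve,
    \<open>B\<close> those inside other than \<open>p0\<close>.\<close>
  define A where "A = e ` (Y - {w} - e' ` U)"
  define B where "B = e ` (Y \<inter> e' ` U - {p0})"
  have AB: "A \<union> B = e ` (Y - {w, p0})"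
    using p0 wU by (auto simp: A_def B_def)
  have AU: "A \<inter> U = {}" and BU: "B \<subseteq> U" and pU: "e p0 \<in> U" and bU: "e b0 \<in> U"
    using UY wU p0 b0 by (auto simp: A_def B_def)
  have Afix: "F (0, z) = z" if "z \<in> A" for z
    using that fixF [of 0] p0 by (auto simp: A_def)
  have F0p: "F (0, e p0) = e p0"
    using p0 ee(1) [of p0] pw chart g(2) [of p0] by (auto simp: F0)
  have AU': "A \<inter> inside (e ` g ` C) = {}"
  proof -
    \<comment> \<open>The initial map fixes the points of \<open>A\<close> and is injective, so
      those outside \<open>U\<close> are also outside its image.\<close>
    have "z \<in> U" if "z \<in> A" "z \<in> (\<lambda>z. F (0, z)) ` U" for z
      using that Afix [OF that(1)] injD [OF Fc(2) [of 0]] by force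
    then show ?thesis
      using AU unfolding U' [symmetric] by blast
  qed
  have disjA: "A \<inter> e ` D = {}" if "D \<subseteq> S2 - Y" for D
  proof -
    have "e v \<noteq> e x" if "v \<in> Y - {w}" "x \<in> D" for v x
      using einj [of v x] that \<open>D \<subseteq> S2 - Y\<close> chart w by blast
    then show ?thesis
      unfolding A_def by blast
  qed
  have Aout: "A \<subseteq> outside (e ` C)" "A \<subseteq> outside (e ` g ` C)"
    using disjA [OF CY(1)] AU disjA [OF CY(2)] AU' unfolding outside_inside U_def by (simp_all add: disjoint_eq_subset_Compl)
  have "disjnt (e ` C) (e ` g ` C)" if "disjnt C (g ` C)"
  proof -
    have "e x \<noteq> e x'" if "x \<in> C" "x' \<in> g ` C" for x x'
      using einj [of x x'] that CY w \<open>disjnt C (g ` C)\<close> unfolding disjnt_iff by blast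
    then show ?thesis
      unfolding disjnt_iff by blast
  qed
  then have eC: "e ` C = e ` g ` C \<or> disjnt (e ` C) (e ` g ` C)"
    using C(3) by metis
  have pU': "e p0 \<in> inside (e ` g ` C)"
    using F0p pU unfolding U' [symmetric] by (metis image_eqI)
  \<comment> \<open>The outside of the larger of the two nested curves contains \<open>A\<close> and
    avoids both insides.\<close>
  obtain W where W: "W \<in> {outside (e ` C), outside (e ` g ` C)}" "W \<inter> U = {}" "W \<inter> inside (e ` g ` C) = {}"
    using disjoint_Jordan_curves_outside [OF c(1,2) c'(1,2), unfolded c(3) c'(3), folded U_def, OF eC pU pU']
    by blast
  have bW: "bounded (- W)"
  proof -
    have "- outside (e ` C) = inside (e ` C) \<union> e ` C" "- outside (e ` g ` C) = inside (e ` g ` C) \<union> e ` g ` C"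
      by (simp_all add: outside_inside Un_commute)
    moreover have "bounded (e ` C)" "bounded (e ` g ` C)"
      using c c' by (metis bounded_simple_path_image)+
    ultimately show ?thesis
      using W(1) J(3) J'(3) by (auto simp: U_def)
  qed
  have "homotopic_paths (- (A \<union> B)) (\<lambda>t. F (t, e p0)) (linepath (e p0) (e p0))"
  proof (rule isotopy_trace_nullhomotopic [OF Fc(1,2) Gc(1,2), where b = "e b0" and d = "e d0" and W = W and U = U])
    show "F (t, z) = z" if "t \<in> {0..1}" "z \<in> A \<union> B \<union> {e d0}" for t z
      using that d0 fixF unfolding AB by auto
    show "G (t, z) = z" if "t \<in> {0..1}" "z \<in> B \<union> {e d0, e p0}" for t z
    proof -
      have "z \<in> e ` (Y - {w, a0})"
        using that(2) d0 p0 a0 wU by (auto simp: B_def)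
      then show ?thesis
        using fixG that(1) by auto
    qed
    show "finite A" "finite B"
      using Y(1) by (auto simp: A_def B_def)
    show "e b0 \<in> B"
      using b0 by (auto simp: B_def)
    show "e d0 \<noteq> e b0" 
      using einj d0 b0 pw chart by auto
    show "open W" "connected W"
      using W(1) J(5,6) J'(5,6) by auto
    show "A \<subseteq> W"
      using W(1) Aout by auto
    show "B \<inter> W = {}" "U \<inter> W = {}" "(\<lambda>z. F (0, z)) ` U \<inter> W = {}"
      using W BU U' by auto
    show "e p0 \<notin> B"
    proof
      assume "e p0 \<in> B"
      then obtain v where "v \<in> Y" "v \<in> e' ` U" "v \<noteq> p0" "e p0 = e v"
        by (auto simp: B_def)
      then show False
        using einj [of p0 v] p0 pw wU chart by blast
    qed
  qed (use J(1,2) bW pU bU F0 G0 F1 in auto)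
  moreover have "closed (A \<union> B)"
    using Y(1) by (auto simp: A_def B_def intro!: finite_imp_closed)
  ultimately have "isotopy_carries (A \<union> B) (\<lambda>t. F (t, e p0)) (linepath (e p0) (e p0))"
    using homotopic_paths_imp_isotopy_carries by blast
  then obtain \<Phi> R where P: "continuous_on ({0..1} \<times> UNIV) \<Phi>"
      "\<forall>t\<in>{0..1}. bij (\<lambda>z. \<Phi> (t, z)) \<and> \<Phi> (t, F (t, e p0)) = linepath (e p0) (e p0) t \<and>
         (\<forall>z. z \<in> A \<union> B \<or> R < norm z \<longrightarrow> \<Phi> (t, z) = z)"
      "\<forall>z. \<Phi> (0, z) = z \<and> \<Phi> (1, z) = z"
    unfolding isotopy_carries_def by (elim exE conjE) (rule that, assumption+)
  have \<Phi>: "continuous_on ({0..1} \<times> UNIV) \<Phi>"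
      "\<And>t. t \<in> {0..1} \<Longrightarrow> bij (\<lambda>z. \<Phi> (t, z))" "\<And>t. t \<in> {0..1} \<Longrightarrow> \<Phi> (t, F (t, e p0)) = e p0"
      "\<And>t z. t \<in> {0..1} \<Longrightarrow> z \<in> A \<union> B \<Longrightarrow> \<Phi> (t, z) = z"
      "\<And>t z. t \<in> {0..1} \<Longrightarrow> R < norm z \<Longrightarrow> \<Phi> (t, z) = z" "\<And>z. \<Phi> (0, z) = z" "\<And>z. \<Phi> (1, z) = z"
    using P by (auto simp: linepath_refl)
  \<comment> \<open>The correcting pushes, carried back to the sphere with \<open>w\<close>
    fixed.\<close>
  define \<Psi> where "\<Psi> = (\<lambda>(t, x). if x = w then w else e' (\<Phi> (t, e x)))"
  have \<Psi>: "continuous_on ({0..1} \<times> S2) \<Psi>" "\<And>t. t \<in> {0..1} \<Longrightarrow> bij_betw (\<lambda>x. \<Psi> (t, x)) S2 S2"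
    unfolding \<Psi>_def by (rule plane_isotopy_extends [OF e wS \<Phi>(1), where R = R]; use \<Phi>(2,5) in simp)+
  have HS: "H1 (t, x) \<in> S2" if "t \<in> {0..1}" "x \<in> S2" for t x
    using H1(2) [OF that(1)] that(2) by (auto simp: bij_betw_def)
  show ?thesis
  \<comment> \<open>At each time the push follows \<open>H1\<close> and returns \<open>p0\<close> to
    its place. It fixes the other marked points, and being trivial at times 0 and 1 it keeps the
    ends \<open>g\<close> and \<open>id\<close>.\<close>
  proof (rule isotopic_relI [where H = "\<lambda>x. \<Psi> (fst x, H1 x)"])
    show "continuous_on ({0..1} \<times> S2) (\<lambda>x. \<Psi> (fst x, H1 x))"
      using HS by (intro continuous_on_compose2 [OF \<Psi>(1)] continuous_intros H1(1)) auto
    show "bij_betw (\<lambda>x. \<Psi> (fst (t, x), H1 (t, x))) S2 S2" if "t \<in> {0..1}" for t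
      using bij_betw_trans [OF H1(2) [OF that] \<Psi>(2) [OF that]] by (simp add: comp_def)
    show "\<Psi> (fst (0, x), H1 (0, x)) = g x" if "x \<in> S2" for x
      using HS [of 0 x] that H1(3) [OF that] ee(1) by (simp add: \<Psi>_def \<Phi>(6,7))
    show "\<Psi> (fst (1, x), H1 (1, x)) = id x" if "x \<in> S2" for x
      using that H1(4) [OF that] ee(1) by (simp add: \<Psi>_def \<Phi>(6,7))
    show "\<Psi> (fst (t, v), H1 (t, v)) = v" if t: "t \<in> {0..1}" and v: "v \<in> Y" for t v
    proof -
      consider "v = w" | "v = p0" | "v \<in> Y - {w, p0}"
        using v by blast
      then show ?thesis
      proof cases
        case 1
        then show ?thesis
          using H1w [OF t] by (simp add: \<Psi>_def)
      next
        case 2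
        have p: "e' (e p0) = p0"
          using p0 pw chart ee(1) by blast
        have "H1 (t, p0) \<noteq> w"
          using Fc(3) [OF t, of "e p0"] p by simp
        moreover have "F (t, e p0) = e (H1 (t, p0))"
          by (simp add: F_def p)
        ultimately show ?thesis
          using \<Phi>(3) [OF t] p 2 by (simp add: \<Psi>_def)
      next
        case 3
        then have "e v \<in> A \<union> B" "H1 (t, v) = v" "v \<noteq> w" "e' (e v) = v"
          using AB H1(5) [OF t, of v] ee(1) [of v] chart by auto
        then show ?thesis
          using \<Phi>(4) [OF t] by (simp add: \<Psi>_def)
      qed
    qed
  qed
qed

theorem theorem4p2:
  fixes n :: nat and y :: "nat \<Rightarrow> nat \<Rightarrow> real"
    and f :: "(nat \<Rightarrow> real) \<Rightarrow> (nat \<Rightarrow> real)"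
  assumes "5 \<le> n"
    and "y ` {..<n} \<subseteq> S2" and "inj_on y {..<n}"
    and "in_Br n y f"
    and "reducible (y ` {..<n}) f"
  shows "isotopic_rel (y ` {..<n}) f id"
proof -
  define Y where "Y = y ` {..<n}"
  have Y: "finite Y" "Y \<subseteq> S2" "5 \<le> card Y"
    using assms(1-3) by (auto simp: Y_def card_image)
  have f: "f v = v" if "v \<in> Y" for v
    using that assms(4) by (auto simp: in_Br_def pure_mc_def Y_def)
  have fBr: "isotopic_rel (Y - {v}) f id" if v: "v \<in> Y" for v
  proof -
    obtain i where i: "i < n" "v = y i"
      using v by (auto simp: Y_def)
    then have "Y - {v} = y ` ({..<n} - {i})"
      using assms(3) by (auto simp: Y_def inj_on_def)
    then show ?thesis
      using assms(4) i by (simp add: in_Br_def)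
  qed
  obtain g \<C> where g: "orient_pres_homeo g" "isotopic_rel Y f g"
    and \<C>: "\<C> \<noteq> {}" "pairwise disjnt \<C>" "\<forall>C\<in>\<C>. essential_curve Y C" "(\<lambda>C. g ` C) ` \<C> = \<C>"
    using assms(5) unfolding reducible_def Y_def [symmetric] by (elim exE conjE) (rule that, assumption+)
  \<comment> \<open>Any member of the family will do: its image is again a member, hence equal to it
    or disjoint from it.\<close>
  obtain C where C: "C \<in> \<C>" "g ` C \<in> \<C>"
    using \<C> by blast
  obtain k where k: "homeomorphism S2 S2 g k"
    using g(1) by (auto simp: orient_pres_homeo_def)
  obtain H :: "real \<times> (nat \<Rightarrow> real) \<Rightarrow> nat \<Rightarrow> real" where H: "continuous_on ({0..1} \<times> S2) H"
    "\<And>t. t \<in> {0..1} \<Longrightarrow> bij_betw (\<lambda>x. H (t, x)) S2 S2"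
    "\<And>x. x \<in> S2 \<Longrightarrow> H (0, x) = f x" "\<And>x. x \<in> S2 \<Longrightarrow> H (1, x) = g x"
    "\<And>t y. t \<in> {0..1} \<Longrightarrow> y \<in> Y \<Longrightarrow> H (t, y) = y"
    using isotopic_relE [OF g(2) Y(1,2) f] by blast
  have gfix: "g v = v" if "v \<in> Y" for v
    using H(4) [of v] H(5) [of 1 v] that Y(2) by auto
  have "isotopic_rel (Y - {v}) g id" if "v \<in> Y" for v
  proof -
    \<comment> \<open>Forgetting \<open>v\<close> is legitimate because \<open>H\<close> fixes
      \<open>Y\<close> pointwise, not merely as a set.\<close>
    have "isotopic_rel (Y - {v}) f g"
      by (rule isotopic_relI [OF H(1-4)]) (use H(5) in auto)
    moreover have "Y - {v} \<subseteq> S2"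
      using Y(2) by blast
    ultimately show ?thesis
      using fBr [OF that] isotopic_rel_sym isotopic_rel_trans by metis
  qed
  moreover have "essential_curve Y C" "essential_curve Y (g ` C)" "C = g ` C \<or> disjnt C (g ` C)"
    using \<C>(2,3) C unfolding pairwise_def by metis+
  ultimately have "isotopic_rel Y g id"
    using reduced_Brunnian_isotopic_to_id [OF Y k gfix] by metis
  then show ?thesis
    using isotopic_rel_trans [OF Y(2) g(2)] by (simp add: Y_def)
qed

end
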